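(* Let $L>0$, $\epsilon>0$ and $\Delta>0$. Then there exist sequences $\{v^{(j)}\}\subset\mathcal{A}_3$ such that (i) $\mathcal{L}^2(B(v^{(j)}))>0$ for all sufficiently large $j$; (ii) $\mathcal{L}^2(B(v^{(j)}))\to 0$ as $j\to\infty$; and (iii) $E_3(v^{(j)};\epsilon,\Delta)-E_3(0;\epsilon,\Delta)\to 0$ as $j\to\infty$.
   Context: Let $\Omega=[0,L]\times[0,1]\subset\mathbb{R}^2$ with coordinates $(x,y)$. $\mathcal{L}^2$ is two-dimensional Lebesgue measure, and subscripts $x,y$ denote (weak) partial derivatives. For a function $u$ on $\Omega$ put $B(u)=\{(x,y)\in\Omega:\ |u_y(x,y)|\ge 1\}$ and $A(u)=\Omega\setminus B(u)$ and define $$E_3(u;\epsilon,\Delta)=\int_\Omega \epsilon^2|D^2u|^2+u_x^2\,d\mathcal{L}^2+\Delta\,\mathcal{L}^2(A(u)),$$ where $D^2u=\nabla(\nabla u)$. Let $W^{1,2}_p(\Omega,\mathbb{R})=\{u\in W^{1,2}(\Omega,\mathbb{R}): u(x,1)=u(x,0),\ 0\le x\le L\}$ (in the sense of traces) and $\mathcal{A}_3=\{u\in W^{1,2}_p(\Omega,\mathbb{R}): \nabla u\in W^{1,2}(\Omega),\ u(0,y)=0 \text{ for } 0\le y\le 1\}$ (boundary values in the sense of traces). *)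

theory Defs
  imports "HOL-Analysis.Analysis"
begin

(* Functions on a set are represented by total functions whose values outside
   the set play no role.  "lebesgue" is complete, so values on null sets, such
   as the boundary of a rectangle, do not affect measurability. *)

definition L2_on :: "'a::euclidean_space set \<Rightarrow> ('a \<Rightarrow> real) \<Rightarrow> bool" where
  "L2_on S f \<longleftrightarrow>
     f \<in> borel_measurable (lebesgue_on S) \<and> integrable (lebesgue_on S) (\<lambda>z. (f z)\<^sup>2)"

definition loc_integrable_on :: "'a::euclidean_space set \<Rightarrow> ('a \<Rightarrow> real) \<Rightarrow> bool" where
  "loc_integrable_on U f \<longleftrightarrow> (\<forall>K. compact K \<and> K \<subseteq> U \<longrightarrow> integrable (lebesgue_on K) f)"

primrec C_diff :: "nat \<Rightarrow> ('a::euclidean_space \<Rightarrow> real) \<Rightarrow> bool" where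
  "C_diff 0 f \<longleftrightarrow> continuous_on UNIV f"
| "C_diff (Suc k) f \<longleftrightarrow>
     (\<forall>z. f differentiable (at z)) \<and>
     (\<forall>i\<in>Basis. C_diff k (\<lambda>z. frechet_derivative f (at z) i))"

definition test_functions :: "'a::euclidean_space set \<Rightarrow> ('a \<Rightarrow> real) set" where
  "test_functions U =
     {\<phi>. (\<forall>k. C_diff k \<phi>) \<and> compact (closure {z. \<phi> z \<noteq> 0}) \<and> closure {z. \<phi> z \<noteq> 0} \<subseteq> U}"

definition has_weak_deriv ::
  "'a::euclidean_space set \<Rightarrow> 'a \<Rightarrow> ('a \<Rightarrow> real) \<Rightarrow> ('a \<Rightarrow> real) \<Rightarrow> bool" where
  "has_weak_deriv U i u g \<longleftrightarrow>
     loc_integrable_on U u \<and> loc_integrable_on U g \<and>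
     (\<forall>\<phi>\<in>test_functions U.
        integral\<^sup>L (lebesgue_on U) (\<lambda>z. u z * frechet_derivative \<phi> (at z) i) =
        - integral\<^sup>L (lebesgue_on U) (\<lambda>z. g z * \<phi> z))"

(* A representative: on an open set U the weak derivative is unique up to a null set. *)
definition weak_deriv ::
  "'a::euclidean_space set \<Rightarrow> 'a \<Rightarrow> ('a \<Rightarrow> real) \<Rightarrow> 'a \<Rightarrow> real" where
  "weak_deriv U i u = (SOME g. has_weak_deriv U i u g)"

definition W12 :: "'a::euclidean_space set \<Rightarrow> ('a \<Rightarrow> real) set" where
  "W12 U = {u. L2_on U u \<and> (\<forall>i\<in>Basis. \<exists>g. has_weak_deriv U i u g \<and> L2_on U g)}"

definition Om :: "real \<Rightarrow> (real \<times> real) set" where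
  "Om L = {0..L} \<times> {0..1}"

definition dx :: "real \<Rightarrow> (real \<times> real \<Rightarrow> real) \<Rightarrow> real \<times> real \<Rightarrow> real" where
  "dx L = weak_deriv (interior (Om L)) (1, 0)"

definition dy :: "real \<Rightarrow> (real \<times> real \<Rightarrow> real) \<Rightarrow> real \<times> real \<Rightarrow> real" where
  "dy L = weak_deriv (interior (Om L)) (0, 1)"

(* Squared W12-distance between the C1 function w and u. *)
definition W12_dist_sq ::
  "real \<Rightarrow> (real \<times> real \<Rightarrow> real) \<Rightarrow> (real \<times> real \<Rightarrow> real) \<Rightarrow> real" where
  "W12_dist_sq L w u = integral\<^sup>L (lebesgue_on (Om L)) (\<lambda>z.
      (w z - u z)\<^sup>2 + (frechet_derivative w (at z) (1, 0) - dx L u z)\<^sup>2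
                   + (frechet_derivative w (at z) (0, 1) - dy L u z)\<^sup>2)"

definition L2_boundary :: "real \<Rightarrow> (real \<times> real \<Rightarrow> real) \<Rightarrow> bool" where
  "L2_boundary L g \<longleftrightarrow>
     L2_on {0..L} (\<lambda>x. g (x, 0)) \<and> L2_on {0..L} (\<lambda>x. g (x, 1)) \<and>
     L2_on {0..1} (\<lambda>y. g (0, y)) \<and> L2_on {0..1} (\<lambda>y. g (L, y))"

definition boundary_norm_sq :: "real \<Rightarrow> (real \<times> real \<Rightarrow> real) \<Rightarrow> real" where
  "boundary_norm_sq L h =
     integral\<^sup>L (lebesgue_on {0..L}) (\<lambda>x. (h (x, 0))\<^sup>2 + (h (x, 1))\<^sup>2) +
     integral\<^sup>L (lebesgue_on {0..1}) (\<lambda>y. (h (0, y))\<^sup>2 + (h (L, y))\<^sup>2)"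

(* g is the trace of u: the continuous extension to W12 of the restriction to
   the boundary of functions that are C1 up to the boundary.  It is unique up
   to null sets of the boundary. *)
definition has_trace ::
  "real \<Rightarrow> (real \<times> real \<Rightarrow> real) \<Rightarrow> (real \<times> real \<Rightarrow> real) \<Rightarrow> bool" where
  "has_trace L u g \<longleftrightarrow>
     u \<in> W12 (interior (Om L)) \<and> L2_boundary L g \<and>
     (\<exists>w. (\<forall>n::nat. C_diff 1 (w n)) \<and>
          (\<lambda>n. W12_dist_sq L (w n) u) \<longlonglongrightarrow> 0 \<and>
          (\<lambda>n. boundary_norm_sq L (\<lambda>z. w n z - g z)) \<longlonglongrightarrow> 0)"

definition W12_per :: "real \<Rightarrow> (real \<times> real \<Rightarrow> real) set" where
  "W12_per L = {u \<in> W12 (interior (Om L)).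
     \<exists>g. has_trace L u g \<and> (AE x in lebesgue_on {0..L}. g (x, 1) = g (x, 0))}"

definition A3 :: "real \<Rightarrow> (real \<times> real \<Rightarrow> real) set" where
  "A3 L = {u \<in> W12_per L.
     dx L u \<in> W12 (interior (Om L)) \<and> dy L u \<in> W12 (interior (Om L)) \<and>
     (\<exists>g. has_trace L u g \<and> (AE y in lebesgue_on {0..1}. g (0, y) = 0))}"

definition Bset :: "real \<Rightarrow> (real \<times> real \<Rightarrow> real) \<Rightarrow> (real \<times> real) set" where
  "Bset L u = {z \<in> Om L. \<bar>dy L u z\<bar> \<ge> 1}"

definition Aset :: "real \<Rightarrow> (real \<times> real \<Rightarrow> real) \<Rightarrow> (real \<times> real) set" where
  "Aset L u = Om L - Bset L u"

definition hess_norm_sq :: "real \<Rightarrow> (real \<times> real \<Rightarrow> real) \<Rightarrow> real \<times> real \<Rightarrow> real" where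
  "hess_norm_sq L u z =
     (dx L (dx L u) z)\<^sup>2 + (dy L (dx L u) z)\<^sup>2 + (dx L (dy L u) z)\<^sup>2 + (dy L (dy L u) z)\<^sup>2"

definition E3 :: "real \<Rightarrow> real \<Rightarrow> real \<Rightarrow> (real \<times> real \<Rightarrow> real) \<Rightarrow> real" where
  "E3 L \<epsilon> \<Delta> u =
     integral\<^sup>L (lebesgue_on (Om L)) (\<lambda>z. \<epsilon>\<^sup>2 * hess_norm_sq L u z + (dx L u z)\<^sup>2)
     + \<Delta> * measure lebesgue (Aset L u)"

end

theory Submission
  imports Defs
begin

text \<open>
  A small energy does not force \<open>|u\<^sub>y| < 1\<close> almost everywhere, because the gradient of \<open>u\<close> lies only
  in \<open>W\<^sup>1\<^sup>,\<^sup>2\<close> of a planar domain, the critical case in which \<open>W\<^sup>1\<^sup>,\<^sup>2\<close> does not embed into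
  bounded functions. So \<open>u\<^sub>y\<close> can be raised above 1 near a point at an arbitrarily small cost
  in \<open>\<integral> |D\<^sup>2 u|\<^sup>2\<close>.

  The spikes which do this are built from one smooth profile \<open>p\<close>, supported in the unit disc and
  equal to \<open>2 y\<close> on the disc of radius \<open>1/2\<close>. In two dimensions the rescaling
  \<open>r p ((z - c) / r)\<close> changes neither the bound on the gradient nor the \<open>L\<^sup>2\<close> norm of the second
  derivatives. The second derivatives live in the annulus \<open>r / 2 < |z - c| \<le> r\<close>, so for
  \<open>r = \<rho> / 2\<^sup>k\<close> with different \<open>k\<close> they have disjoint supports. The average \<open>v\<^sub>j\<close> of these
  functions over \<open>k = j, ..., 2 j\<close> still has \<open>\<partial>\<^sub>y v\<^sub>j = 2\<close> near \<open>c\<close>, while orthogonality gives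
  \<open>\<integral> |D\<^sup>2 v\<^sub>j|\<^sup>2 = O(1 / (j + 1))\<close>. Since the gradients are uniformly bounded and the
  supports shrink to \<open>c\<close>, the term \<open>\<integral> u\<^sub>x\<^sup>2\<close> and the measure of the threshold set
  tend to 0 as well (\<open>integral_classical_density_spike_le\<close>, \<open>pd_spike_center\<close>).

  All \<open>v\<^sub>j\<close> are test functions on the open rectangle, so their traces vanish. The remaining work
  is to identify the weak derivatives, which are chosen representatives, with the
  classical ones. This needs existence, that is, integration by parts
  (\<open>has_weak_deriv_classical\<close>), and uniqueness almost everywhere (\<open>has_weak_deriv_unique\<close>),
  which rests on the fundamental lemma of the calculus of variations. The smooth functions needed
  there and for \<open>p\<close> come from \<open>exp (- 1 / t)\<close>.
\<close>

section \<open>Calculus of finitely differentiable functions\<close>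

abbreviation pd :: "'a::euclidean_space \<Rightarrow> ('a \<Rightarrow> real) \<Rightarrow> 'a \<Rightarrow> real" where
  "pd i f \<equiv> (\<lambda>z. frechet_derivative f (at z) i)"

declare C_diff.simps(2) [simp del]

lemma pd_eqI: "(f has_derivative f') (at z) \<Longrightarrow> pd i f z = f' i"
  by (simp add: frechet_derivative_at[symmetric])

lemma C_diff_differentiable: "C_diff (Suc k) f \<Longrightarrow> f differentiable (at z)"
  by (simp add: C_diff.simps(2))

lemma C_diff_pd: "C_diff (Suc k) f \<Longrightarrow> i \<in> Basis \<Longrightarrow> C_diff k (pd i f)"
  by (simp add: C_diff.simps(2))

lemma C_diff_continuous: "C_diff k f \<Longrightarrow> continuous_on S f"
proof (cases k)
  case 0
  then show "C_diff k f \<Longrightarrow> continuous_on S f"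
    using continuous_on_subset by auto
next
  case (Suc n)
  then show "C_diff k f \<Longrightarrow> continuous_on S f"
    by (auto intro!: continuous_at_imp_continuous_on differentiable_imp_continuous_within
          simp: C_diff.simps(2))
qed

lemma C_diff_SucD: "C_diff (Suc k) f \<Longrightarrow> C_diff k f"
proof (induction k arbitrary: f)
  case 0
  then show ?case using C_diff_continuous by (metis C_diff.simps(1))
next
  case (Suc k)
  then show ?case
    by (metis C_diff.simps(2))
qed

lemma C_diff_SucI:
  assumes "\<And>z. (f has_derivative f' z) (at z)"
    and "\<And>i. i \<in> Basis \<Longrightarrow> C_diff k (\<lambda>z. f' z i)"
  shows "C_diff (Suc k) f"
proof -
  have "frechet_derivative f (at z) = f' z" for z
    using frechet_derivative_at[OF assms(1)] by simp
  then show ?thesis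
    using assms by (auto simp: differentiable_def C_diff.simps(2))
qed

lemma C_diff_has_derivative:
  "C_diff (Suc k) f \<Longrightarrow> (f has_derivative frechet_derivative f (at z)) (at z)"
  by (simp add: frechet_derivative_works[symmetric] C_diff_differentiable)

lemma C_diff_const: "C_diff k (\<lambda>z. c)"
proof (induction k arbitrary: c)
  case (Suc k)
  show ?case by (rule C_diff_SucI[where f' = "\<lambda>_ _. 0"]) (auto intro: Suc)
qed auto

lemma C_diff_bounded_linear: "bounded_linear f \<Longrightarrow> C_diff k f"
proof (cases k)
  case 0
  then show "bounded_linear f \<Longrightarrow> C_diff k f" by (simp add: linear_continuous_on)
next
  case (Suc n)
  then show "bounded_linear f \<Longrightarrow> C_diff k f"
    using C_diff_SucI[where f' = "\<lambda>_. f"] C_diff_const bounded_linear_imp_has_derivative by blast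
qed

lemma C_diff_add: "C_diff k f \<Longrightarrow> C_diff k g \<Longrightarrow> C_diff k (\<lambda>z. f z + g z)"
proof (induction k arbitrary: f g)
  case (Suc k)
  show ?case
    by (rule C_diff_SucI[OF has_derivative_add[OF C_diff_has_derivative C_diff_has_derivative]])
      (use Suc in \<open>auto dest: C_diff_pd\<close>)
qed (auto intro: continuous_intros)

lemma C_diff_mult: "C_diff k f \<Longrightarrow> C_diff k g \<Longrightarrow> C_diff k (\<lambda>z. f z * g z)"
proof (induction k arbitrary: f g)
  case (Suc k)
  show ?case
    by (rule C_diff_SucI[OF has_derivative_mult[OF C_diff_has_derivative C_diff_has_derivative]])
      (auto intro!: C_diff_add Suc.IH C_diff_pd Suc.prems C_diff_SucD[OF Suc.prems(1)]
        C_diff_SucD[OF Suc.prems(2)])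
qed (auto intro: continuous_intros)

lemma C_diff_cmult: "C_diff k f \<Longrightarrow> C_diff k (\<lambda>z. c * f z)"
  by (rule C_diff_mult[OF C_diff_const])

lemma C_diff_diff: "C_diff k f \<Longrightarrow> C_diff k g \<Longrightarrow> C_diff k (\<lambda>z. f z - g z)"
  using C_diff_add[OF _ C_diff_cmult[of k g "-1"]] by simp

lemma C_diff_sum: "(\<And>j. j \<in> J \<Longrightarrow> C_diff k (f j)) \<Longrightarrow> C_diff k (\<lambda>z. \<Sum>j\<in>J. f j z)"
  by (induction J rule: infinite_finite_induct) (auto intro: C_diff_add C_diff_const)

lemma C_diff_prod: "(\<And>j. j \<in> J \<Longrightarrow> C_diff k (f j)) \<Longrightarrow> C_diff k (\<lambda>z. \<Prod>j\<in>J. f j z)"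
  by (induction J rule: infinite_finite_induct) (auto intro: C_diff_mult C_diff_const)

lemma C_diff_power: "C_diff k f \<Longrightarrow> C_diff k (\<lambda>z. f z ^ n)"
  by (induction n) (auto intro: C_diff_mult C_diff_const)

text \<open>
  The induction generalises over both functions, because the chain rule replaces the outer one
  by its derivative.
\<close>

lemma C_diff_compose:
  fixes F :: "real \<Rightarrow> real"
  shows "C_diff k F \<Longrightarrow> C_diff k g \<Longrightarrow> C_diff k (\<lambda>z. F (g z))"
proof (induction k arbitrary: F g)
  case 0
  then show ?case
    using continuous_on_compose2[of UNIV F UNIV g] by auto
next
  case (Suc k)
  note F = C_diff_has_derivative[OF Suc.prems(1)] and g = C_diff_has_derivative[OF Suc.prems(2)]
  have lin: "frechet_derivative F (at t) h = pd 1 F t * h" for t h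
    using linear_cmul[OF has_derivative_linear[OF F[of t]], of h 1] by (simp add: mult.commute)
  show ?case
  proof (rule C_diff_SucI)
    show "((\<lambda>z. F (g z)) has_derivative (\<lambda>h. pd 1 F (g z) * frechet_derivative g (at z) h)) (at z)" for z
      using diff_chain_at[OF g F, of z] by (simp add: o_def flip: lin)
    show "C_diff k (\<lambda>z. pd 1 F (g z) * frechet_derivative g (at z) i)" if "i \<in> Basis" for i
      by (rule C_diff_mult[OF Suc.IH[OF C_diff_pd C_diff_SucD] C_diff_pd]) (use Suc.prems that in auto)
  qed
qed

lemma has_derivative_rescale:
  fixes f :: "'a::euclidean_space \<Rightarrow> real"
  assumes "C_diff (Suc k) f"
  shows "((\<lambda>z. f (c *\<^sub>R (z - a))) has_derivative
          (\<lambda>h. c * frechet_derivative f (at (c *\<^sub>R (z - a))) h)) (at z)"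
proof -
  have "((\<lambda>z. c *\<^sub>R (z - a)) has_derivative (\<lambda>h. c *\<^sub>R h)) (at z)"
    by (auto intro!: derivative_eq_intros)
  from diff_chain_at[OF this C_diff_has_derivative[OF assms]]
  show ?thesis
    using linear_cmul[OF has_derivative_linear[OF C_diff_has_derivative[OF assms]]]
    by (simp add: o_def)
qed

lemma pd_rescale:
  "C_diff (Suc k) f \<Longrightarrow> pd i (\<lambda>z. f (c *\<^sub>R (z - a))) z = c * pd i f (c *\<^sub>R (z - a))"
  by (rule pd_eqI[OF has_derivative_rescale])

lemma C_diff_rescale:
  fixes f :: "'a::euclidean_space \<Rightarrow> real"
  shows "C_diff k f \<Longrightarrow> C_diff k (\<lambda>z. f (c *\<^sub>R (z - a)))"
proof (induction k arbitrary: f)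
  case 0
  have "continuous_on UNIV (\<lambda>z. c *\<^sub>R (z - a))"
    by (intro continuous_intros)
  then show ?case
    using 0 continuous_on_compose2[of UNIV f UNIV "\<lambda>z. c *\<^sub>R (z - a)"] by auto
next
  case (Suc k)
  show ?case
    by (rule C_diff_SucI[OF has_derivative_rescale[OF Suc.prems]])
      (auto intro!: C_diff_cmult Suc.IH C_diff_pd Suc.prems)
qed

lemma pd_mult:
  "C_diff (Suc k) f \<Longrightarrow> C_diff (Suc k) g \<Longrightarrow>
   pd i (\<lambda>z. f z * g z) z = f z * pd i g z + pd i f z * g z"
  by (rule pd_eqI[OF has_derivative_mult[OF C_diff_has_derivative C_diff_has_derivative]])

lemma pd_cmult: "C_diff (Suc k) f \<Longrightarrow> pd i (\<lambda>z. c * f z) z = c * pd i f z"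
  by (rule pd_eqI[OF has_derivative_mult_right[OF C_diff_has_derivative]])

lemma pd_sum:
  "(\<And>j. j \<in> J \<Longrightarrow> C_diff (Suc k) (f j)) \<Longrightarrow>
   pd i (\<lambda>z. \<Sum>j\<in>J. f j z) z = (\<Sum>j\<in>J. pd i (f j) z)"
  by (rule pd_eqI[OF has_derivative_sum[OF C_diff_has_derivative]])

lemma pd_cong_open:
  assumes "open S" "z \<in> S" "\<And>w. w \<in> S \<Longrightarrow> f w = g w" "C_diff (Suc k) g"
  shows "pd i f z = pd i g z"
proof -
  have "(f has_derivative frechet_derivative g (at z)) (at z)"
    by (rule has_derivative_transform_within_open[OF C_diff_has_derivative[OF assms(4)] assms(1,2)])
      (simp add: assms(3))
  from pd_eqI[OF this] show ?thesis .
qed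

lemma pd_const: "pd i (\<lambda>z. c) z = 0"
  by (rule pd_eqI[OF has_derivative_const])

lemma pd_linear: "bounded_linear f \<Longrightarrow> pd i f z = f i"
  by (rule pd_eqI[OF bounded_linear_imp_has_derivative])

section \<open>Smooth bump functions\<close>

text \<open>
  The functions \<open>t \<mapsto> t\<^sup>-\<^sup>m exp (- 1 / t)\<close>, extended by 0 to \<open>t \<le> 0\<close>. Only \<open>m = 0\<close> is wanted;
  the whole family is considered because derivatives of its members are linear combinations of
  its members, which makes smoothness an induction.
\<close>

definition flat :: "nat \<Rightarrow> real \<Rightarrow> real" where
  "flat m t = (if t > 0 then exp (- inverse t) * inverse t ^ m else 0)"

text \<open>
  Faster-than-polynomial decay of \<open>exp (- 1 / t)\<close> at 0: the only point at which
  differentiability is not a matter of the calculus rules.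
\<close>

lemma flat_over_id_tendsto: "((\<lambda>t. flat m t / t) \<longlongrightarrow> 0) (at 0)"
proof -
  have R: "((\<lambda>t. flat m t / t) \<longlongrightarrow> 0) (at_right 0)"
  proof -
    have "((\<lambda>t. t ^ Suc m / exp t) \<longlongrightarrow> 0) (at_top::real filter)"
      by (rule tendsto_power_div_exp_0)
    then have "((\<lambda>t::real. inverse t ^ Suc m / exp (inverse t)) \<longlongrightarrow> 0) (at_right 0)"
      using filterlim_compose filterlim_inverse_at_top_right by blast
    then show ?thesis
      by (rule Lim_transform_eventually)
        (auto simp: eventually_at_filter flat_def exp_minus field_simps)
  qed
  have L: "((\<lambda>t. flat m t / t) \<longlongrightarrow> 0) (at_left 0)"
    by (rule tendsto_eventually) (auto simp: eventually_at_filter flat_def)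
  show ?thesis using L R by (simp add: filterlim_split_at)
qed

lemma flat_has_real_derivative:
  "(flat m has_real_derivative (flat (m + 2) t - m * flat (Suc m) t)) (at t)"
proof -
  consider "t > 0" | "t < 0" | "t = 0" by linarith
  then show ?thesis
  proof cases
    case 1
    have "((\<lambda>t. exp (- inverse t) * inverse t ^ m) has_real_derivative
        (flat (m + 2) t - m * flat (Suc m) t)) (at t)"
      by (cases m, use 1 in \<open>auto intro!: derivative_eq_intros simp: flat_def power2_eq_square\<close>)
        (auto simp: algebra_simps power_eq_if[of _ "_::nat"])
    then show ?thesis
      by (rule has_field_derivative_transform_within_open[where S = "{0<..}"])
        (use 1 in \<open>auto simp: flat_def\<close>)
  next
    case 2
    have "((\<lambda>t. 0) has_real_derivative (flat (m + 2) t - m * flat (Suc m) t)) (at t)"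
      using 2 by (auto simp: flat_def)
    then show ?thesis
      by (rule has_field_derivative_transform_within_open[where S = "{..<0}"])
        (use 2 in \<open>auto simp: flat_def\<close>)
  next
    case 3
    then show ?thesis
      using flat_over_id_tendsto[of m] by (simp add: has_field_derivative_iff flat_def)
  qed
qed

lemma C_diff_flat: "C_diff k (flat m)"
proof (induction k arbitrary: m)
  case 0
  have "isCont (flat m) t" for t
    by (rule DERIV_isCont[OF flat_has_real_derivative])
  then show ?case
    by (simp add: continuous_at_imp_continuous_on)
next
  case (Suc k)
  show ?case
    by (rule C_diff_SucI[OF flat_has_real_derivative[unfolded has_field_derivative_def]])
      (auto intro!: C_diff_diff C_diff_cmult Suc)
qed

lemma flat_0_bounds: "0 \<le> flat 0 t" "flat 0 t \<le> 1"
  by (auto simp: flat_def)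

lemma flat_0_eq_0_iff: "flat 0 t = 0 \<longleftrightarrow> t \<le> 0"
  by (auto simp: flat_def)

text \<open>
  A smooth function with values in \<open>[0, 1]\<close> that is positive exactly on the open box.
\<close>

definition box_bump :: "'a::euclidean_space \<Rightarrow> 'a \<Rightarrow> 'a \<Rightarrow> real" where
  "box_bump a b z = (\<Prod>i\<in>Basis. flat 0 ((z - a) \<bullet> i) * flat 0 ((b - z) \<bullet> i))"

lemma C_diff_inner: "C_diff k (\<lambda>z. z \<bullet> i)"
  by (rule C_diff_bounded_linear[OF bounded_linear_inner_left])

lemma C_diff_box_bump: "C_diff k (box_bump a b)"
  unfolding box_bump_def[abs_def] inner_diff_left
  by (intro C_diff_prod C_diff_mult C_diff_compose[OF C_diff_flat] C_diff_diff C_diff_const C_diff_inner)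

lemma box_bump_bounds: "0 \<le> box_bump a b z" "box_bump a b z \<le> 1"
  unfolding box_bump_def
  by (auto intro!: prod_nonneg prod_le_1 mult_le_one simp: flat_0_bounds)

lemma box_bump_eq_0_iff: "box_bump a b z = 0 \<longleftrightarrow> z \<notin> box a b"
  by (auto simp: box_bump_def mem_box flat_0_eq_0_iff inner_diff_left not_less)

lemma box_bump_outside_cbox: "z \<notin> cbox a b \<Longrightarrow> box_bump a b z = 0"
  using box_subset_cbox by (auto simp: box_bump_eq_0_iff)

lemma test_functionsI:
  assumes "\<And>k. C_diff k \<phi>" "compact K" "K \<subseteq> U" "\<And>z. z \<notin> K \<Longrightarrow> \<phi> z = 0"
  shows "\<phi> \<in> test_functions U"
proof -
  have sub: "closure {z. \<phi> z \<noteq> 0} \<subseteq> K"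
    using assms(2,4) by (intro closure_minimal) (auto intro: compact_imp_closed)
  then have "compact (closure {z. \<phi> z \<noteq> 0})"
    using assms(2) by (auto simp: compact_eq_bounded_closed intro: bounded_subset)
  then show ?thesis
    using assms(1,3) sub unfolding test_functions_def by blast
qed

text \<open>
  With \<open>\<psi>\<close> the bump of a box, the functions \<open>1 - (1 - \<psi>)\<^sup>n\<close> are smooth, vanish outside
  the box, and increase with \<open>n\<close> to the indicator of the box. They serve as smooth
  approximations of indicators without any mollification.
\<close>

lemma box_test_function:
  assumes "cbox a b \<subseteq> U"
  shows "(\<lambda>z. 1 - (1 - box_bump a b z) ^ n) \<in> test_functions U"
  by (rule test_functionsI[OF _ compact_cbox assms])
    (auto simp: box_bump_outside_cbox
      intro!: C_diff_diff C_diff_power C_diff_const C_diff_box_bump)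

lemma box_test_function_tendsto:
  "(\<lambda>n. 1 - (1 - box_bump a b z) ^ n) \<longlonglongrightarrow> indicator (box a b) z"
proof (cases "z \<in> box a b")
  case True
  then have "box_bump a b z > 0"
    using box_bump_bounds(1)[of a b z] box_bump_eq_0_iff[of a b z] by linarith
  then have "(\<lambda>n. (1 - box_bump a b z) ^ n) \<longlonglongrightarrow> 0"
    using box_bump_bounds[of a b z] by (intro LIMSEQ_realpow_zero) auto
  from tendsto_diff[OF tendsto_const this, of 1] True show ?thesis by simp
next
  case False
  then show ?thesis by (simp add: box_bump_eq_0_iff[THEN iffD2])
qed

section \<open>The fundamental lemma of the calculus of variations\<close>

lemma loc_integrable_on_cbox:
  assumes "loc_integrable_on U h" "cbox a b \<subseteq> U"
  shows "integrable lebesgue (\<lambda>z. indicator (cbox a b) z * h z)"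
proof -
  have "integrable (lebesgue_on (cbox a b)) h"
    using assms by (auto simp: loc_integrable_on_def)
  then show ?thesis
    by (subst (asm) integrable_restrict_space) auto
qed

lemma loc_integrable_on_box:
  assumes "loc_integrable_on U h" "cbox a b \<subseteq> U"
  shows "integrable lebesgue (\<lambda>z. indicator (box a b) z * h z)"
proof -
  have "integrable lebesgue (\<lambda>z. indicator (box a b) z *\<^sub>R (indicator (cbox a b) z * h z))"
    by (rule integrable_mult_indicator[OF _ loc_integrable_on_cbox[OF assms]]) auto
  also have "(\<lambda>z. indicator (box a b) z *\<^sub>R (indicator (cbox a b) z * h z)) = (\<lambda>z. indicator (box a b) z * h z)"
    using box_subset_cbox[of a b] by (auto simp: indicator_def fun_eq_iff)
  finally show ?thesis .
qed

lemma continuous_measurable_lebesgue: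
  "continuous_on UNIV (f :: 'a::euclidean_space \<Rightarrow> real) \<Longrightarrow> f \<in> borel_measurable lebesgue"
  using borel_measurable_continuous_onI measurable_completion by (metis measurable_lborel2)

text \<open>
  Testing \<open>h\<close> against the approximations of the indicator of the box and passing to the limit
  by dominated convergence.
\<close>

lemma integral_box_eq_0:
  assumes U: "open U" and h: "loc_integrable_on U h"
    and orth: "\<And>\<phi>. \<phi> \<in> test_functions U \<Longrightarrow> integral\<^sup>L (lebesgue_on U) (\<lambda>z. h z * \<phi> z) = 0"
    and sub: "cbox a b \<subseteq> U"
  shows "integral\<^sup>L lebesgue (\<lambda>z. indicator (box a b) z * h z) = 0"
proof -
  define s where "s n z = indicator U z * (h z * (1 - (1 - box_bump a b z) ^ n))" for n z
  have s_eq: "s n z = (1 - (1 - box_bump a b z) ^ n) * (indicator (cbox a b) z * h z)" for n z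
    using sub by (auto simp: s_def indicator_def box_bump_outside_cbox)
  have s0: "integral\<^sup>L lebesgue (s n) = 0" for n
    using orth[OF box_test_function[OF sub], of n] U
    by (subst (asm) integral_restrict_space) (auto simp: s_def[abs_def])
  have "continuous_on UNIV (\<lambda>z. 1 - (1 - box_bump a b z) ^ n)" for n
    by (rule C_diff_continuous[of 0])
      (intro C_diff_diff C_diff_power C_diff_const C_diff_box_bump)
  then have meas: "(\<lambda>z. 1 - (1 - box_bump a b z) ^ n) \<in> borel_measurable lebesgue" for n
    by (rule continuous_measurable_lebesgue)
  have "(\<lambda>n. integral\<^sup>L lebesgue (s n)) \<longlonglongrightarrow> integral\<^sup>L lebesgue (\<lambda>z. indicator (box a b) z * h z)"
  proof (rule integral_dominated_convergence)
    show "(\<lambda>z. indicator (box a b) z * h z) \<in> borel_measurable lebesgue"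
      using loc_integrable_on_box[OF h sub] by auto
    show "integrable lebesgue (\<lambda>z. norm (indicator (cbox a b) z * h z))"
      using loc_integrable_on_cbox[OF h sub] by (rule integrable_norm)
    show "s n \<in> borel_measurable lebesgue" for n
      unfolding s_eq[abs_def]
      by (rule borel_measurable_times[OF meas]) (use loc_integrable_on_cbox[OF h sub] in auto)
    have "(\<lambda>n. s n z) \<longlonglongrightarrow> indicator (box a b) z * h z" for z
    proof -
      have "(\<lambda>n. s n z) \<longlonglongrightarrow> indicator (box a b) z * (indicator (cbox a b) z * h z)"
        unfolding s_eq by (intro tendsto_mult box_test_function_tendsto tendsto_const)
      also have "indicator (box a b) z * (indicator (cbox a b) z * h z) = indicator (box a b) z * h z"
        using box_subset_cbox[of a b] by (auto simp: indicator_def)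
      finally show ?thesis .
    qed
    then show "AE z in lebesgue. (\<lambda>n. s n z) \<longlonglongrightarrow> indicator (box a b) z * h z" by simp
    have "norm (s n z) \<le> norm (indicator (cbox a b) z * h z)" for n z
    proof -
      have "0 \<le> (1 - box_bump a b z) ^ n" "(1 - box_bump a b z) ^ n \<le> 1"
        using box_bump_bounds[of a b z] by (auto intro: power_le_one)
      then have "\<bar>1 - (1 - box_bump a b z) ^ n\<bar> \<le> 1" by linarith
      then show ?thesis
        unfolding s_eq norm_mult by (intro mult_left_le_one_le) auto
    qed
    then show "AE z in lebesgue. norm (s n z) \<le> norm (indicator (cbox a b) z * h z)" for n by simp
  qed
  then show ?thesis
    by (simp add: s0 LIMSEQ_const_iff)
qed

text \<open>
  Boxes are stable under intersection and generate the Borel sets. The sets over which \<open>f\<close> has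
  integral 0 form a Dynkin system, where closure under complements uses that the total integral
  vanishes. Hence they include all Borel sets, then all Lebesgue sets, and averaging gives the claim.
\<close>

lemma AE_eq_0_if_box_integrals_eq_0:
  fixes f :: "'a::euclidean_space \<Rightarrow> real"
  assumes f: "integrable lebesgue f"
    and total: "integral\<^sup>L lebesgue f = 0"
    and boxes: "\<And>a b. (LINT z:box a b|lebesgue. f z) = 0"
  shows "AE z in lebesgue. f z = 0"
proof -
  have si: "set_integrable lebesgue A f" if "A \<in> sets lebesgue" for A
    unfolding set_integrable_def by (rule integrable_mult_indicator[OF that f])
  have borel0: "(LINT z:A|lebesgue. f z) = 0" if A: "A \<in> sets borel" for A
  proof -
    have "Int_stable (range (\<lambda>(a, b::'a). box a b))"
      by (auto simp: Int_stable_def box_Int_box)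
    moreover have "range (\<lambda>(a, b::'a). box a b) \<subseteq> Pow UNIV" by auto
    moreover have "A \<in> sigma_sets UNIV (range (\<lambda>(a, b). box a b))"
      using A unfolding borel_eq_box by simp
    ultimately show ?thesis
    proof (induction rule: sigma_sets_induct_disjoint)
      case (basic A)
      then show ?case using boxes by auto
    next
      case empty
      then show ?case by (simp add: set_lebesgue_integral_def)
    next
      case (compl A)
      have "A \<in> sets lebesgue"
        using compl(1) borel_eq_box[where 'a='a] by (metis sets_completionI_sets sets_lborel sets_measure_of top_greatest Pow_UNIV)
      then have "(LINT z:A \<union> (UNIV - A)|lebesgue. f z) =
          (LINT z:A|lebesgue. f z) + (LINT z:UNIV - A|lebesgue. f z)"
        by (intro set_integral_Un si) auto
      then show ?case
        using compl(2) total by (simp add: set_lebesgue_integral_def)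
    next
      case (union A)
      have "A i \<in> sets lebesgue" for i
        using union(2) borel_eq_box[where 'a='a] by (metis range_subsetD sets_completionI_sets sets_lborel sets_measure_of top_greatest Pow_UNIV)
      then show ?case
        using union by (subst lebesgue_integral_countable_add)
          (auto intro!: si simp: disjoint_family_on_def)
    qed
  qed
  \<comment> \<open>A Lebesgue set differs from a Borel set by a null set.\<close>
  have "(LINT z:A|lebesgue. f z) = 0" if A: "A \<in> sets lebesgue" for A
  proof -
    obtain S N N' where "A = S \<union> N" "N \<subseteq> N'" "N' \<in> null_sets lborel" and S: "S \<in> sets lborel"
      using A by (elim sets_completionE)
    then have "AE z in lebesgue. indicator A z *\<^sub>R f z = indicator S z *\<^sub>R f z"
      by (intro AE_I'[of N']) (auto simp: null_sets_completionI indicator_def)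
    then have "(LINT z:A|lebesgue. f z) = (LINT z:S|lebesgue. f z)"
      unfolding set_lebesgue_integral_def using A S si[unfolded set_integrable_def]
      by (intro integral_cong_AE borel_measurable_integrable) auto
    then show ?thesis using borel0 S by simp
  qed
  moreover have "sigma_finite_measure (lebesgue :: 'a measure)"
  proof -
    obtain F :: "'a set set" where "countable F" "F \<subseteq> sets lborel" "\<Union>F = space lborel" "\<forall>a\<in>F. emeasure lborel a \<noteq> \<infinity>"
      using lborel.sigma_finite_countable by blast
    then show ?thesis
      by (intro sigma_finite_measure.intro exI[of _ F]) auto
  qed
  ultimately show ?thesis
    using sigma_finite_measure.density_zero f by blast
qed

text \<open>
  The function is only locally integrable, so the vanishing of box integrals is exploited on one
  box with compact closure in \<open>U\<close> at a time; countably many of them cover \<open>U\<close>.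
\<close>

lemma fundamental_lemma_calculus_of_variations:
  fixes h :: "'a::euclidean_space \<Rightarrow> real"
  assumes U: "open U" and h: "loc_integrable_on U h"
    and orth: "\<And>\<phi>. \<phi> \<in> test_functions U \<Longrightarrow> integral\<^sup>L (lebesgue_on U) (\<lambda>z. h z * \<phi> z) = 0"
  shows "AE z in lebesgue_on U. h z = 0"
proof -
  have on_box: "AE z in lebesgue. z \<in> box a b \<longrightarrow> h z = 0" if sub: "cbox a b \<subseteq> U" for a b
  proof -
    have "(LINT z:box c d|lebesgue. indicator (box a b) z * h z) = 0" for c d
    proof -
      obtain p q where pq: "box a b \<inter> box c d = box p q"
        using box_Int_box by blast
      show ?thesis
      proof (cases "box p q = {}")
        case True
        then have "indicator (box c d) z *\<^sub>R (indicator (box a b) z * h z) = 0" for z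
          using pq by (auto simp: indicator_def)
        then show ?thesis by (simp only: set_lebesgue_integral_def Bochner_Integration.integral_zero)
      next
        case False
        then have "cbox p q \<subseteq> cbox a b"
          by (metis Int_lower1 box_subset_cbox closure_box closure_minimal closed_cbox order_trans pq)
        then have "integral\<^sup>L lebesgue (\<lambda>z. indicator (box p q) z * h z) = 0"
          using integral_box_eq_0[OF U h orth] sub by blast
        moreover have "indicator (box c d) z *\<^sub>R (indicator (box a b) z * h z) = indicator (box p q) z * h z" for z
          by (auto simp: indicator_def simp flip: pq)
        ultimately show ?thesis by (simp only: set_lebesgue_integral_def)
      qed
    qed
    then have "AE z in lebesgue. indicator (box a b) z * h z = 0"
      by (intro AE_eq_0_if_box_integrals_eq_0 loc_integrable_on_box[OF h sub] integral_box_eq_0[OF U h orth sub])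
    then show ?thesis by (auto simp: indicator_def)
  qed
  obtain \<D> where D: "countable \<D>" "\<D> \<subseteq> Pow U" "\<And>X. X \<in> \<D> \<Longrightarrow> \<exists>a b. X = cbox a b" "\<Union>\<D> = U"
    using open_countable_Union_open_cbox[OF U] by blast
  have "AE z in lebesgue. \<forall>X\<in>\<D>. z \<in> X \<longrightarrow> h z = 0"
  proof (subst AE_ball_countable[OF D(1)], intro ballI)
    fix X assume X: "X \<in> \<D>"
    then obtain a b where ab: "X = cbox a b" using D(3) by blast
    have "AE z in lebesgue. z \<notin> cbox a b - box a b"
      by (rule AE_not_in) (use negligible_frontier_interval[of a b] in \<open>simp add: negligible_iff_null_sets\<close>)
    moreover have "AE z in lebesgue. z \<in> box a b \<longrightarrow> h z = 0"
      using D(2) X ab by (intro on_box) auto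
    ultimately show "AE z in lebesgue. z \<in> X \<longrightarrow> h z = 0"
      unfolding ab by eventually_elim auto
  qed
  then have "AE z in lebesgue. z \<in> U \<longrightarrow> h z = 0"
    by eventually_elim (use D(4) in auto)
  then show ?thesis
    using U by (subst AE_restrict_space_iff) auto
qed

section \<open>Weak derivatives of smooth functions\<close>

lemma pd_outside_support:
  assumes "compact K" "\<And>z. z \<notin> K \<Longrightarrow> f z = 0" "z \<notin> K"
  shows "pd i f z = 0"
proof -
  have "pd i f z = pd i (\<lambda>_. 0) z"
    by (rule pd_cong_open[of "- K", OF _ _ _ C_diff_const])
      (use assms in \<open>auto intro: compact_imp_closed\<close>)
  then show ?thesis by (simp add: pd_const)
qed

lemma bounded_compact_support:
  fixes f :: "'a::euclidean_space \<Rightarrow> real"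
  assumes "continuous_on UNIV f" "compact K" "\<And>z. z \<notin> K \<Longrightarrow> f z = 0"
  obtains M where "M \<ge> 0" "\<And>z. \<bar>f z\<bar> \<le> M"
proof -
  have "bounded (f ` K)"
    by (intro compact_imp_bounded compact_continuous_image continuous_on_subset[OF assms(1)] assms(2)) auto
  then obtain M where M: "\<And>z. z \<in> K \<Longrightarrow> \<bar>f z\<bar> \<le> M"
    by (auto simp: bounded_iff)
  show ?thesis
  proof (rule that)
    show "\<bar>f z\<bar> \<le> max M 0" for z
      using M[of z] assms(3)[of z] by (cases "z \<in> K") auto
  qed simp
qed

lemma integrable_lborel_compact_support:
  fixes f :: "'a::euclidean_space \<Rightarrow> real"
  assumes "continuous_on UNIV f" "compact K" "\<And>z. z \<notin> K \<Longrightarrow> f z = 0"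
  shows "integrable lborel f"
proof -
  have "integrable lborel (\<lambda>z. indicator K z *\<^sub>R f z)"
    by (rule borel_integrable_compact[OF assms(2) continuous_on_subset[OF assms(1)]]) auto
  also have "(\<lambda>z. indicator K z *\<^sub>R f z) = f"
    using assms(3) by (auto simp: indicator_def fun_eq_iff)
  finally show ?thesis .
qed

lemma integrable_lebesgue_compact_support:
  fixes f :: "'a::euclidean_space \<Rightarrow> real"
  assumes "continuous_on UNIV f" "compact K" "\<And>z. z \<notin> K \<Longrightarrow> f z = 0"
  shows "integrable lebesgue f"
  using integrable_lborel_compact_support[OF assms] by (simp add: integrable_completion)

text \<open>
  The integral of a compactly supported function is invariant under translation, so the integrals
  of its difference quotients in direction \<open>i\<close> vanish. These quotients are bounded by the supremum
  of the derivative (mean value theorem) and live in a fixed ball, so dominated convergence applies.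
  This avoids Fubini and works in all dimensions at once.
\<close>

lemma integral_pd_eq_0:
  fixes w :: "'a::euclidean_space \<Rightarrow> real"
  assumes w: "C_diff (Suc 0) w" and K: "compact K" and off: "\<And>z. z \<notin> K \<Longrightarrow> w z = 0" and i: "i \<in> Basis"
  shows "integral\<^sup>L lebesgue (pd i w) = 0"
proof -
  have cw: "continuous_on UNIV w" and cp: "continuous_on UNIV (pd i w)"
    using C_diff_continuous[OF w] C_diff_continuous[OF C_diff_pd[OF w i]] by auto
  obtain M where M: "M \<ge> 0" "\<And>z. \<bar>pd i w z\<bar> \<le> M"
    using bounded_compact_support[OF cp K pd_outside_support[OF K off]] by blast
  obtain R where R: "\<And>z. z \<in> K \<Longrightarrow> norm z \<le> R"
    using compact_imp_bounded[OF K] by (auto simp: bounded_iff)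
  define h where "h n = inverse (real (Suc n))" for n
  have h: "0 < h n" "h n \<le> 1" for n
    by (auto simp: h_def field_simps)
  define q where "q n z = (w (h n *\<^sub>R i + z) - w z) / h n" for n z
  have line: "((\<lambda>t. w (t *\<^sub>R i + z)) has_real_derivative pd i w (t *\<^sub>R i + z)) (at t)" for t z
  proof -
    have "((\<lambda>t. t *\<^sub>R i + z) has_derivative (\<lambda>s. s *\<^sub>R i)) (at t)"
      by (auto intro!: derivative_eq_intros)
    from diff_chain_at[OF this C_diff_has_derivative[OF w]]
    show ?thesis
      using linear_cmul[OF has_derivative_linear[OF C_diff_has_derivative[OF w]]]
      by (simp add: o_def has_field_derivative_def mult_commute_abs)
  qed
  have "(\<lambda>n. q n z) \<longlonglongrightarrow> pd i w z" for z
  proof -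
    have "((\<lambda>s. (w (s *\<^sub>R i + z) - w z) / s) \<longlongrightarrow> pd i w z) (at 0)"
      using line[of z 0] by (simp add: has_field_derivative_iff)
    moreover have "filterlim h (at 0) sequentially"
      unfolding filterlim_at using LIMSEQ_inverse_real_of_nat h(1)
      by (auto simp: h_def[abs_def])
    ultimately show ?thesis
      unfolding q_def by (rule filterlim_compose)
  qed
  moreover have "\<bar>q n z\<bar> \<le> M * indicator (cball 0 (R + 1)) z" for n z
  proof (cases "z \<in> cball 0 (R + 1)")
    case True
    obtain s where "w (h n *\<^sub>R i + z) - w (0 *\<^sub>R i + z) = (h n - 0) * pd i w (s *\<^sub>R i + z)"
      using MVT2[OF h(1)[of n], of "\<lambda>t. w (t *\<^sub>R i + z)" "\<lambda>t. pd i w (t *\<^sub>R i + z)"] line by blast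
    then show ?thesis
      using M(2) h(1)[of n] True by (simp add: q_def)
  next
    case False
    have "norm z \<le> norm (h n *\<^sub>R i + z) + norm (h n *\<^sub>R i)"
      using norm_triangle_sub[of z "h n *\<^sub>R i + z"] by (simp add: norm_minus_commute)
    also have "norm (h n *\<^sub>R i) \<le> 1"
      using h[of n] i by simp
    finally have "z \<notin> K" "h n *\<^sub>R i + z \<notin> K"
      using R[of z] R[of "h n *\<^sub>R i + z"] False by auto
    then show ?thesis using off M(1) by (simp add: q_def)
  qed
  moreover have "integral\<^sup>L lborel (q n) = 0" for n
  proof -
    have iw: "integrable lborel w"
      by (rule integrable_lborel_compact_support[OF cw K off])
    have m: "w \<in> borel_measurable borel"
      by (rule borel_measurable_continuous_onI[OF cw])
    have "integral\<^sup>L lborel w = integral\<^sup>L lborel (\<lambda>z. w (h n *\<^sub>R i + z))"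
      by (subst lborel_distr_plus[symmetric, of "h n *\<^sub>R i"], subst integral_distr) (use m in auto)
    moreover have "integrable lborel (\<lambda>z. w (h n *\<^sub>R i + z))"
      using iw by (subst (asm) lborel_distr_plus[symmetric, of "h n *\<^sub>R i"], subst (asm) integrable_distr_eq)
        (use m in auto)
    ultimately show ?thesis
      using iw by (simp add: q_def[abs_def])
  qed
  moreover have "(\<lambda>n. integral\<^sup>L lborel (q n)) \<longlonglongrightarrow> integral\<^sup>L lborel (pd i w)"
  proof (rule integral_dominated_convergence)
    show "integrable lborel (\<lambda>z. M * indicator (cball (0::'a) (R + 1)) z)"
      using emeasure_lborel_cball_finite by (auto intro!: integrable_real_indicator)
    show "pd i w \<in> borel_measurable lborel"
      using borel_measurable_continuous_onI[OF cp] by simp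
    show "q n \<in> borel_measurable lborel" for n
    proof -
      have "continuous_on UNIV (q n)"
        unfolding q_def[abs_def] using h(1)[of n]
        by (intro continuous_intros continuous_on_compose2[OF cw]) auto
      then show ?thesis using borel_measurable_continuous_onI by simp
    qed
  qed (use calculation in auto)
  ultimately have "integral\<^sup>L lborel (pd i w) = 0"
    by (simp add: LIMSEQ_const_iff)
  then show ?thesis
    by (subst integral_completion) (simp_all add: borel_measurable_continuous_onI[OF cp])
qed

lemma integral_lebesgue_on_support:
  assumes "U \<in> sets lebesgue" "\<And>z. z \<notin> U \<Longrightarrow> f z = (0::real)"
  shows "integrable (lebesgue_on U) f \<longleftrightarrow> integrable lebesgue f"
    and "integral\<^sup>L (lebesgue_on U) f = integral\<^sup>L lebesgue f"
proof -
  have "(\<lambda>z. indicator U z *\<^sub>R f z) = f"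
    using assms(2) by (auto simp: indicator_def fun_eq_iff)
  then show "integrable (lebesgue_on U) f \<longleftrightarrow> integrable lebesgue f"
    and "integral\<^sup>L (lebesgue_on U) f = integral\<^sup>L lebesgue f"
    using assms(1) by (simp_all add: integrable_restrict_space integral_restrict_space)
qed

lemma loc_integrable_on_continuous:
  fixes f :: "'a::euclidean_space \<Rightarrow> real"
  assumes "continuous_on UNIV f"
  shows "loc_integrable_on U f"
  unfolding loc_integrable_on_def
proof (intro allI impI)
  fix K :: "'a set" assume K: "compact K \<and> K \<subseteq> U"
  then have int: "integrable lborel (\<lambda>z. indicator K z *\<^sub>R f z)"
    by (intro borel_integrable_compact continuous_on_subset[OF assms]) auto
  then have "integrable lebesgue (\<lambda>z. indicator K z *\<^sub>R f z)"
    by (subst integrable_completion[OF borel_measurable_integrable[OF int]])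
  moreover have "K \<in> sets lebesgue"
    using K by (simp add: lmeasurable_compact fmeasurableD)
  ultimately show "integrable (lebesgue_on K) f"
    by (subst integrable_restrict_space) auto
qed

lemma test_functionsE:
  assumes "\<phi> \<in> test_functions U"
  obtains K where "compact K" "K \<subseteq> U" "\<And>z. z \<notin> K \<Longrightarrow> \<phi> z = 0"
proof (rule that)
  show "compact (closure {z. \<phi> z \<noteq> 0})" "closure {z. \<phi> z \<noteq> 0} \<subseteq> U"
    using assms by (auto simp: test_functions_def)
  show "\<phi> z = 0" if "z \<notin> closure {z. \<phi> z \<noteq> 0}" for z
    using that closure_subset[of "{z. \<phi> z \<noteq> 0}"] by blast
qed

lemma test_functions_C_diff: "\<phi> \<in> test_functions U \<Longrightarrow> C_diff k \<phi>"
  by (simp add: test_functions_def)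

lemma test_functions_pd:
  assumes "\<phi> \<in> test_functions U" "i \<in> Basis"
  shows "pd i \<phi> \<in> test_functions U"
proof -
  obtain K where K: "compact K" "K \<subseteq> U" "\<And>z. z \<notin> K \<Longrightarrow> \<phi> z = 0"
    using test_functionsE[OF assms(1)] by blast
  show ?thesis
    by (rule test_functionsI[OF _ K(1,2) pd_outside_support[OF K(1,3)]])
      (rule C_diff_pd[OF test_functions_C_diff[OF assms(1)] assms(2)])
qed

text \<open>
  The default value 0 of the integral of a nonintegrable function would spoil
  additivity, so the integrals in the definition of weak derivatives have to exist.
\<close>

lemma integrable_loc_integrable_mult_test:
  fixes g :: "'a::euclidean_space \<Rightarrow> real"
  assumes g: "loc_integrable_on U g" and \<phi>: "\<phi> \<in> test_functions U" and U: "U \<in> sets lebesgue"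
  shows "integrable (lebesgue_on U) (\<lambda>z. g z * \<phi> z)"
proof -
  obtain K where K: "compact K" "K \<subseteq> U" "\<And>z. z \<notin> K \<Longrightarrow> \<phi> z = 0"
    using test_functionsE[OF \<phi>] by blast
  have K': "K \<in> sets lebesgue"
    using K(1) by (simp add: lmeasurable_compact fmeasurableD)
  have c: "continuous_on UNIV \<phi>"
    using C_diff_continuous test_functions_C_diff[OF \<phi>] by blast
  then obtain M where M: "\<And>z. \<bar>\<phi> z\<bar> \<le> M"
    using bounded_compact_support[OF c K(1,3)] by blast
  have "integrable (lebesgue_on K) g"
    using g K by (auto simp: loc_integrable_on_def)
  then have gK: "integrable lebesgue (\<lambda>z. indicator K z * g z)"
    using K' by (subst (asm) integrable_restrict_space) auto
  have "integrable lebesgue (\<lambda>z. \<phi> z * (indicator K z * g z))"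
  proof (rule Bochner_Integration.integrable_bound[OF integrable_mult_right[OF gK, of M]])
    show "(\<lambda>z. \<phi> z * (indicator K z * g z)) \<in> borel_measurable lebesgue"
      by (rule borel_measurable_times[OF continuous_measurable_lebesgue[OF c]])
        (use gK in auto)
    show "AE z in lebesgue. norm (\<phi> z * (indicator K z * g z)) \<le> norm (M * (indicator K z * g z))"
      by (auto simp: abs_mult indicator_def intro!: mult_right_mono order_trans[OF M])
  qed
  also have "(\<lambda>z. \<phi> z * (indicator K z * g z)) = (\<lambda>z. g z * \<phi> z)"
    using K(3) by (auto simp: indicator_def fun_eq_iff)
  finally show ?thesis
    by (subst integral_lebesgue_on_support(1)[OF U]) (use K in auto)
qed

lemma has_weak_deriv_unique:
  fixes u :: "'a::euclidean_space \<Rightarrow> real"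
  assumes U: "open U" and g: "has_weak_deriv U i u g" and g': "has_weak_deriv U i u g'"
  shows "AE z in lebesgue_on U. g z = g' z"
proof -
  have loc: "loc_integrable_on U g" "loc_integrable_on U g'"
    using g g' by (auto simp: has_weak_deriv_def)
  have "AE z in lebesgue_on U. g z - g' z = 0"
  proof (rule fundamental_lemma_calculus_of_variations[OF U])
    show "loc_integrable_on U (\<lambda>z. g z - g' z)"
      using loc by (auto simp: loc_integrable_on_def)
    fix \<phi> :: "'a \<Rightarrow> real" assume \<phi>: "\<phi> \<in> test_functions U"
    have "integral\<^sup>L (lebesgue_on U) (\<lambda>z. g z * \<phi> z) = integral\<^sup>L (lebesgue_on U) (\<lambda>z. g' z * \<phi> z)"
      using g g' \<phi> by (force simp: has_weak_deriv_def)
    then show "integral\<^sup>L (lebesgue_on U) (\<lambda>z. (g z - g' z) * \<phi> z) = 0"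
      using integrable_loc_integrable_mult_test[OF _ \<phi>] loc U by (simp add: left_diff_distrib)
  qed
  then show ?thesis by simp
qed

text \<open>
  Integration by parts: the derivative of the compactly supported function \<open>u \<phi>\<close> has integral 0.
\<close>

lemma has_weak_deriv_classical:
  fixes u :: "'a::euclidean_space \<Rightarrow> real"
  assumes u: "C_diff (Suc 0) u" and i: "i \<in> Basis" and U: "open U"
  shows "has_weak_deriv U i u (pd i u)"
  unfolding has_weak_deriv_def
proof (intro conjI ballI)
  show loc: "loc_integrable_on U u" "loc_integrable_on U (pd i u)"
    by (auto intro!: loc_integrable_on_continuous C_diff_continuous[OF u] C_diff_continuous[OF C_diff_pd[OF u i]])
  fix \<phi> :: "'a \<Rightarrow> real" assume \<phi>: "\<phi> \<in> test_functions U"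
  obtain K where K: "compact K" "K \<subseteq> U" "\<And>z. z \<notin> K \<Longrightarrow> \<phi> z = 0"
    using test_functionsE[OF \<phi>] by blast
  have C: "C_diff (Suc 0) \<phi>" by (rule test_functions_C_diff[OF \<phi>])
  have U': "U \<in> sets lebesgue" using U by simp
  have "0 = integral\<^sup>L lebesgue (pd i (\<lambda>z. u z * \<phi> z))"
    by (rule integral_pd_eq_0[symmetric, OF C_diff_mult[OF u C] K(1) _ i]) (simp add: K(3))
  also have "\<dots> = integral\<^sup>L (lebesgue_on U) (\<lambda>z. u z * pd i \<phi> z + pd i u z * \<phi> z)"
  proof -
    have "u z * pd i \<phi> z + pd i u z * \<phi> z = 0" if "z \<notin> U" for z
    proof -
      have "z \<notin> K" using that K(2) by blast
      then show ?thesis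
        by (simp add: K(3)[of z] pd_outside_support[of K \<phi> z i, OF K(1,3)])
    qed
    from integral_lebesgue_on_support(2)[OF U' this] show ?thesis
      by (simp add: pd_mult[OF u C])
  qed
  also have "\<dots> = integral\<^sup>L (lebesgue_on U) (\<lambda>z. u z * pd i \<phi> z) + integral\<^sup>L (lebesgue_on U) (\<lambda>z. pd i u z * \<phi> z)"
    using integrable_loc_integrable_mult_test[OF loc(1) test_functions_pd[OF \<phi> i] U']
      integrable_loc_integrable_mult_test[OF loc(2) \<phi> U'] by simp
  finally show "integral\<^sup>L (lebesgue_on U) (\<lambda>z. u z * pd i \<phi> z) = - integral\<^sup>L (lebesgue_on U) (\<lambda>z. pd i u z * \<phi> z)"
    by linarith
qed

text \<open>
  The weak derivative is only an arbitrary representative of its class, so the next lemmas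
  transfer measurability, integrability and weak differentiability along equality almost everywhere.
  Completeness of Lebesgue measure is essential here.
\<close>

lemma borel_measurable_lebesgue_on_cong_AE:
  fixes f g :: "'a::euclidean_space \<Rightarrow> real"
  assumes "f \<in> borel_measurable (lebesgue_on S)" "AE z in lebesgue_on S. f z = g z" "S \<in> sets lebesgue"
  shows "g \<in> borel_measurable (lebesgue_on S)"
proof -
  have "(\<lambda>z. indicator S z *\<^sub>R f z) \<in> borel_measurable lebesgue"
    using assms(1,3) by (subst (asm) borel_measurable_restrict_space_iff) auto
  moreover have "AE z in lebesgue. indicator S z *\<^sub>R f z = indicator S z *\<^sub>R g z"
    using assms(2,3) by (subst (asm) AE_restrict_space_iff) (auto simp: indicator_def)
  ultimately show ?thesis
    using assms(3) borel_measurable_AE[of "\<lambda>z. indicator S z *\<^sub>R f z" "\<lambda>z. indicator S z *\<^sub>R g z"]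
    by (subst borel_measurable_restrict_space_iff) auto
qed

lemma integrable_lebesgue_on_cong_AE:
  fixes f g :: "'a::euclidean_space \<Rightarrow> real"
  assumes "integrable (lebesgue_on S) f" "AE z in lebesgue_on S. f z = g z" "S \<in> sets lebesgue"
  shows "integrable (lebesgue_on S) g" "integral\<^sup>L (lebesgue_on S) g = integral\<^sup>L (lebesgue_on S) f"
proof -
  have m: "g \<in> borel_measurable (lebesgue_on S)"
    using assms borel_measurable_lebesgue_on_cong_AE by blast
  show "integrable (lebesgue_on S) g"
    by (rule integrable_cong_AE_imp[OF assms(1) m]) (use assms(2) in \<open>auto elim: AE_mp\<close>)
  show "integral\<^sup>L (lebesgue_on S) g = integral\<^sup>L (lebesgue_on S) f"
    by (rule integral_cong_AE[OF m]) (use assms in auto)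
qed

lemma has_weak_deriv_cong_AE:
  fixes u :: "'a::euclidean_space \<Rightarrow> real"
  assumes u: "has_weak_deriv U i u g" and eq: "AE z in lebesgue_on U. u z = u' z"
    and U: "open U" and i: "i \<in> Basis"
  shows "has_weak_deriv U i u' g"
  unfolding has_weak_deriv_def
proof (intro conjI ballI)
  have loc: "loc_integrable_on U u" and "loc_integrable_on U g"
    using u by (auto simp: has_weak_deriv_def)
  then show "loc_integrable_on U g" by simp
  show "loc_integrable_on U u'"
    unfolding loc_integrable_on_def
  proof (intro allI impI)
    fix K assume K: "compact K \<and> K \<subseteq> U"
    then have K': "K \<in> sets lebesgue" by (simp add: lmeasurable_compact fmeasurableD)
    have "AE z in lebesgue_on K. u z = u' z"
      using eq K K' U by (auto simp: AE_restrict_space_iff elim: AE_mp)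
    then show "integrable (lebesgue_on K) u'"
      using integrable_lebesgue_on_cong_AE(1) loc K K' by (auto simp: loc_integrable_on_def)
  qed
  fix \<phi> :: "'a \<Rightarrow> real" assume \<phi>: "\<phi> \<in> test_functions U"
  have "integral\<^sup>L (lebesgue_on U) (\<lambda>z. u' z * pd i \<phi> z) = integral\<^sup>L (lebesgue_on U) (\<lambda>z. u z * pd i \<phi> z)"
    by (rule integrable_lebesgue_on_cong_AE(2)[OF
          integrable_loc_integrable_mult_test[OF loc test_functions_pd[OF \<phi> i]]])
      (use U eq in \<open>auto elim: AE_mp\<close>)
  then show "integral\<^sup>L (lebesgue_on U) (\<lambda>z. u' z * pd i \<phi> z) = - integral\<^sup>L (lebesgue_on U) (\<lambda>z. g z * \<phi> z)"
    using u \<phi> by (simp add: has_weak_deriv_def)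
qed

lemma L2_on_test_function_cong_AE:
  fixes u :: "'a::euclidean_space \<Rightarrow> real"
  assumes \<phi>: "\<phi> \<in> test_functions U" and eq: "AE z in lebesgue_on U. \<phi> z = u z" and U: "open U"
  shows "L2_on U u"
proof -
  obtain K where K: "compact K" "K \<subseteq> U" "\<And>z. z \<notin> K \<Longrightarrow> \<phi> z = 0"
    using test_functionsE[OF \<phi>] by blast
  have c: "continuous_on UNIV \<phi>"
    using C_diff_continuous test_functions_C_diff[OF \<phi>] by blast
  have U': "U \<in> sets lebesgue" using U by simp
  have "\<phi> \<in> borel_measurable (lebesgue_on U)"
    using continuous_measurable_lebesgue[OF c] by (simp add: measurable_restrict_space1)
  then have "u \<in> borel_measurable (lebesgue_on U)"
    using borel_measurable_lebesgue_on_cong_AE eq U' by blast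
  moreover have "integrable (lebesgue_on U) (\<lambda>z. (\<phi> z)\<^sup>2)"
    by (subst integral_lebesgue_on_support(1)[OF U'], use K in force,
        rule integrable_lebesgue_compact_support[OF _ K(1)])
      (use c K(3) in \<open>auto intro: continuous_intros\<close>)
  then have "integrable (lebesgue_on U) (\<lambda>z. (u z)\<^sup>2)"
    by (rule integrable_lebesgue_on_cong_AE(1)) (use eq U' in \<open>auto elim: AE_mp\<close>)
  ultimately show ?thesis by (simp add: L2_on_def)
qed

text \<open>
  The form needed for second derivatives: the first weak derivative of a test function equals a test
  function only almost everywhere, so \<open>u\<close> itself has to be allowed to differ from \<open>\<phi>\<close> on a null set.
\<close>

lemma test_function_AE_weak_deriv:
  fixes u :: "'a::euclidean_space \<Rightarrow> real"
  assumes \<phi>: "\<phi> \<in> test_functions U" and eq: "AE z in lebesgue_on U. \<phi> z = u z" and U: "open U" and i: "i \<in> Basis"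
  shows "AE z in lebesgue_on U. pd i \<phi> z = weak_deriv U i u z"
proof -
  have "has_weak_deriv U i u (pd i \<phi>)"
    by (rule has_weak_deriv_cong_AE[OF has_weak_deriv_classical[OF test_functions_C_diff[OF \<phi>] i U] eq U i])
  then show ?thesis
    unfolding weak_deriv_def
    by (intro has_weak_deriv_unique[OF U, of i u] someI[of "has_weak_deriv U i u"])
qed

lemma test_function_AE_W12:
  fixes u :: "'a::euclidean_space \<Rightarrow> real"
  assumes \<phi>: "\<phi> \<in> test_functions U" and eq: "AE z in lebesgue_on U. \<phi> z = u z" and U: "open U"
  shows "u \<in> W12 U"
proof -
  have "has_weak_deriv U i u (pd i \<phi>)" "L2_on U (pd i \<phi>)" if i: "i \<in> Basis" for i
    using has_weak_deriv_cong_AE[OF has_weak_deriv_classical[OF test_functions_C_diff[OF \<phi>] i U] eq U i]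
      L2_on_test_function_cong_AE[OF test_functions_pd[OF \<phi> i] _ U] by auto
  then show ?thesis
    using L2_on_test_function_cong_AE[OF assms] by (auto simp: W12_def)
qed

section \<open>Energy of a test function on the rectangle\<close>

lemma Basis_real_prod: "(Basis :: (real \<times> real) set) = {(1, 0), (0, 1)}"
  by (auto simp: Basis_prod_def)

lemma interior_Om: "interior (Om L) = box (0, 0) (L, 1)" and Om_cbox: "Om L = cbox (0, 0) (L, 1)"
proof -
  show *: "Om L = cbox (0, 0) (L, 1)"
    by (simp add: Om_def cbox_Pair_eq)
  show "interior (Om L) = box (0, 0) (L, 1)"
    unfolding * by (rule interior_cbox)
qed

lemma Om_lmeasurable: "Om L \<in> lmeasurable"
  by (simp add: Om_cbox)

text \<open>
  Weak derivatives are unconstrained on the boundary of the rectangle, which is a null set.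
\<close>

lemma AE_on_Om_if_AE_on_interior:
  assumes "AE z in lebesgue_on (interior (Om L)). P z"
  shows "AE z in lebesgue. z \<in> Om L \<longrightarrow> P z"
proof -
  have "AE z in lebesgue. z \<in> interior (Om L) \<longrightarrow> P z"
    using assms by (subst (asm) AE_restrict_space_iff) auto
  moreover have "AE z in lebesgue. z \<notin> cbox (0, 0) (L, 1::real) - box (0, 0) (L, 1)"
    by (rule AE_not_in) (use negligible_frontier_interval in \<open>simp add: negligible_iff_null_sets\<close>)
  ultimately show ?thesis
    by eventually_elim (auto simp: interior_Om Om_cbox)
qed

text \<open>
  The integrand of the energy with classical in place of weak derivatives.
\<close>

definition classical_density :: "(real \<times> real \<Rightarrow> real) \<Rightarrow> real \<Rightarrow> real \<times> real \<Rightarrow> real" where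
  "classical_density \<phi> \<epsilon> z =
     \<epsilon>\<^sup>2 * ((pd (1, 0) (pd (1, 0) \<phi>) z)\<^sup>2 + (pd (0, 1) (pd (1, 0) \<phi>) z)\<^sup>2
          + (pd (1, 0) (pd (0, 1) \<phi>) z)\<^sup>2 + (pd (0, 1) (pd (0, 1) \<phi>) z)\<^sup>2)
     + (pd (1, 0) \<phi> z)\<^sup>2"

context
  fixes L :: real and \<phi> :: "real \<times> real \<Rightarrow> real"
  assumes \<phi>: "\<phi> \<in> test_functions (interior (Om L))"
begin

lemma test_function_zero_outside: "z \<notin> interior (Om L) \<Longrightarrow> \<phi> z = 0"
  using test_functionsE[OF \<phi>] by (metis subsetD)

lemma AE_first_derivs_test_function:
  "AE z in lebesgue_on (interior (Om L)). pd (1, 0) \<phi> z = dx L \<phi> z"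
  "AE z in lebesgue_on (interior (Om L)). pd (0, 1) \<phi> z = dy L \<phi> z"
  unfolding dx_def dy_def
  by (rule test_function_AE_weak_deriv[OF \<phi>]; simp add: Basis_real_prod)+

lemma AE_second_derivs_test_function:
  "AE z in lebesgue_on (interior (Om L)). pd (1, 0) (pd (1, 0) \<phi>) z = dx L (dx L \<phi>) z"
  "AE z in lebesgue_on (interior (Om L)). pd (0, 1) (pd (1, 0) \<phi>) z = dy L (dx L \<phi>) z"
  "AE z in lebesgue_on (interior (Om L)). pd (1, 0) (pd (0, 1) \<phi>) z = dx L (dy L \<phi>) z"
  "AE z in lebesgue_on (interior (Om L)). pd (0, 1) (pd (0, 1) \<phi>) z = dy L (dy L \<phi>) z"
  unfolding dx_def dy_def
  by (rule test_function_AE_weak_deriv[OF test_functions_pd[OF \<phi>]];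
      use AE_first_derivs_test_function in \<open>simp add: Basis_real_prod dx_def dy_def\<close>)+

text \<open>
  The function approximates itself in the definition of the trace, and it vanishes on
  the boundary.
\<close>

lemma test_function_has_trace_0: "has_trace L \<phi> (\<lambda>z. 0)"
  unfolding has_trace_def
proof (intro conjI exI[of _ "\<lambda>n. \<phi>"] allI)
  show "\<phi> \<in> W12 (interior (Om L))"
    by (rule test_function_AE_W12[OF \<phi>]) auto
  show "L2_boundary L (\<lambda>z. 0)"
    by (simp add: L2_boundary_def L2_on_def)
  show "C_diff 1 \<phi>" by (rule test_functions_C_diff[OF \<phi>])
  have "AE z in lebesgue_on (Om L). (\<phi> z - \<phi> z)\<^sup>2 + (pd (1, 0) \<phi> z - dx L \<phi> z)\<^sup>2 + (pd (0, 1) \<phi> z - dy L \<phi> z)\<^sup>2 = 0"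
    using AE_on_Om_if_AE_on_interior[OF AE_first_derivs_test_function(1)] AE_on_Om_if_AE_on_interior[OF AE_first_derivs_test_function(2)]
    by (subst AE_restrict_space_iff) (auto simp: Om_lmeasurable fmeasurableD elim: eventually_elim2)
  then have "W12_dist_sq L \<phi> \<phi> = 0"
    unfolding W12_dist_sq_def by (rule integral_eq_zero_AE)
  then show "(\<lambda>n. W12_dist_sq L \<phi> \<phi>) \<longlonglongrightarrow> 0" by simp
  have "\<phi> (x, 0) = 0" "\<phi> (x, 1) = 0" "\<phi> (0, y) = 0" "\<phi> (L, y) = 0" for x y
    by (rule test_function_zero_outside; simp add: interior_Om mem_box Basis_real_prod)+
  then show "(\<lambda>n. boundary_norm_sq L (\<lambda>z. \<phi> z - 0)) \<longlonglongrightarrow> 0"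
    by (simp add: boundary_norm_sq_def)
qed

lemma test_function_in_A3: "\<phi> \<in> A3 L"
proof -
  have "\<phi> \<in> W12_per L"
    unfolding W12_per_def using test_function_has_trace_0 by (auto simp: has_trace_def intro!: exI[of _ "\<lambda>z. 0"])
  moreover have "dx L \<phi> \<in> W12 (interior (Om L))" "dy L \<phi> \<in> W12 (interior (Om L))"
    by (rule test_function_AE_W12[OF test_functions_pd[OF \<phi>] AE_first_derivs_test_function(1)]
          test_function_AE_W12[OF test_functions_pd[OF \<phi>] AE_first_derivs_test_function(2)];
        simp add: Basis_real_prod)+
  ultimately show ?thesis
    unfolding A3_def using test_function_has_trace_0 by (auto intro!: exI[of _ "\<lambda>z. 0"])
qed

lemma Bset_test_function:
  "{z \<in> Om L. 1 \<le> \<bar>pd (0, 1) \<phi> z\<bar>} \<in> lmeasurable"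
  "Bset L \<phi> \<in> lmeasurable"
  "measure lebesgue (Bset L \<phi>) = measure lebesgue {z \<in> Om L. 1 \<le> \<bar>pd (0, 1) \<phi> z\<bar>}"
proof -
  let ?B = "{z \<in> Om L. 1 \<le> \<bar>pd (0, 1) \<phi> z\<bar>}"
  have c: "continuous_on UNIV (pd (0, 1) \<phi>)"
    by (rule C_diff_continuous[OF test_functions_C_diff[OF test_functions_pd[OF \<phi>]]])
      (simp add: Basis_real_prod)
  have "closed ({z. 1 \<le> \<bar>pd (0, 1) \<phi> z\<bar>})"
    by (intro closed_Collect_le continuous_intros c)
  then have "compact (Om L \<inter> {z. 1 \<le> \<bar>pd (0, 1) \<phi> z\<bar>})"
    unfolding Om_cbox by (rule compact_Int_closed[OF compact_cbox])
  then show B: "?B \<in> lmeasurable"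
    using lmeasurable_compact by (auto simp: Collect_conj_eq)
  have ae: "AE z in lebesgue. z \<in> ?B \<longleftrightarrow> z \<in> Bset L \<phi>"
    using AE_on_Om_if_AE_on_interior[OF AE_first_derivs_test_function(2)]
    by eventually_elim (auto simp: Bset_def)
  have B': "Bset L \<phi> \<in> sets lebesgue"
    by (rule completion.in_sets_AE[OF ae]) (use B in auto)
  then show "Bset L \<phi> \<in> lmeasurable"
    by (rule fmeasurableI2[OF Om_lmeasurable, rotated]) (auto simp: Bset_def)
  show "measure lebesgue (Bset L \<phi>) = measure lebesgue ?B"
    by (rule measure_eq_AE) (use ae B B' in auto)
qed

lemma E3_test_function:
  "integrable lebesgue (classical_density \<phi> \<epsilon>)"
  "E3 L \<epsilon> \<Delta> \<phi> = integral\<^sup>L lebesgue (classical_density \<phi> \<epsilon>)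
     + \<Delta> * (measure lebesgue (Om L) - measure lebesgue (Bset L \<phi>))"
proof -
  have t: "pd i \<phi> \<in> test_functions (interior (Om L))" if "i \<in> Basis" for i
    using that by (intro test_functions_pd \<phi>)
  note t2 = test_functions_pd[OF t]
  have c: "continuous_on UNIV (classical_density \<phi> \<epsilon>)"
    unfolding classical_density_def[abs_def]
    by (intro continuous_intros C_diff_continuous[OF test_functions_C_diff[OF t]]
        C_diff_continuous[OF test_functions_C_diff[OF t2]])
      (auto simp: Basis_real_prod)
  have off: "classical_density \<phi> \<epsilon> z = 0" if "z \<notin> Om L" for z
  proof -
    have z: "f z = 0" if "f \<in> test_functions (interior (Om L))" for f
      using test_functionsE[OF that] \<open>z \<notin> Om L\<close> interior_subset by (metis subsetD)
    show ?thesis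
      using z[OF t] z[OF t2] by (simp add: classical_density_def Basis_real_prod)
  qed
  have Om: "compact (Om L)" "Om L \<in> sets lebesgue"
    using Om_lmeasurable by (auto simp: Om_cbox)
  show int: "integrable lebesgue (classical_density \<phi> \<epsilon>)"
    by (rule integrable_lebesgue_compact_support[OF c Om(1) off])
  have "AE z in lebesgue_on (Om L). classical_density \<phi> \<epsilon> z = \<epsilon>\<^sup>2 * hess_norm_sq L \<phi> z + (dx L \<phi> z)\<^sup>2"
    using AE_second_derivs_test_function[THEN AE_on_Om_if_AE_on_interior] AE_on_Om_if_AE_on_interior[OF AE_first_derivs_test_function(1)]
    unfolding AE_restrict_space_iff[of "Om L" lebesgue, simplified, OF Om(2)]
    by eventually_elim (simp add: classical_density_def hess_norm_sq_def)
  then have "integral\<^sup>L (lebesgue_on (Om L)) (\<lambda>z. \<epsilon>\<^sup>2 * hess_norm_sq L \<phi> z + (dx L \<phi> z)\<^sup>2)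
      = integral\<^sup>L (lebesgue_on (Om L)) (classical_density \<phi> \<epsilon>)"
    using int integral_lebesgue_on_support(1)[OF Om(2) off]
    by (intro integrable_lebesgue_on_cong_AE(2) Om(2)) auto
  also have "\<dots> = integral\<^sup>L lebesgue (classical_density \<phi> \<epsilon>)"
    by (rule integral_lebesgue_on_support(2)[OF Om(2) off])
  finally have "integral\<^sup>L (lebesgue_on (Om L)) (\<lambda>z. \<epsilon>\<^sup>2 * hess_norm_sq L \<phi> z + (dx L \<phi> z)\<^sup>2)
      = integral\<^sup>L lebesgue (classical_density \<phi> \<epsilon>)" .
  moreover have "measure lebesgue (Aset L \<phi>) = measure lebesgue (Om L) - measure lebesgue (Bset L \<phi>)"
    unfolding Aset_def using Bset_test_function(2) Om_lmeasurable
    by (intro measurable_measure_Diff) (auto simp: Bset_def)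
  ultimately show "E3 L \<epsilon> \<Delta> \<phi> = integral\<^sup>L lebesgue (classical_density \<phi> \<epsilon>)
     + \<Delta> * (measure lebesgue (Om L) - measure lebesgue (Bset L \<phi>))"
    by (simp add: E3_def)
qed

end

lemma E3_diff_test_function:
  assumes "\<phi> \<in> test_functions (interior (Om L))"
  shows "E3 L \<epsilon> \<Delta> \<phi> - E3 L \<epsilon> \<Delta> (\<lambda>z. 0) =
    integral\<^sup>L lebesgue (classical_density \<phi> \<epsilon>) - \<Delta> * measure lebesgue (Bset L \<phi>)"
proof -
  have 0: "(\<lambda>z. 0) \<in> test_functions (interior (Om L))"
    by (rule test_functionsI[of _ "{}"]) (auto intro: C_diff_const)
  have "classical_density (\<lambda>z. 0) \<epsilon> = (\<lambda>z. 0)"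
    by (simp add: classical_density_def fun_eq_iff pd_const)
  then show ?thesis
    using Bset_test_function(3)[OF 0]
    by (simp add: E3_test_function(2)[OF assms] E3_test_function(2)[OF 0] pd_const algebra_simps)
qed

section \<open>The concentrating sequence\<close>

text \<open>
  A smooth function that is 1 up to \<open>1 / 2\<close> and 0 from 1 on. The inner term is 0 up to \<open>1 / 2\<close>, where
  the outer one is \<open>exp 1 * exp (- 1) = 1\<close>. It is at least \<open>exp 2 * exp (- 2) = 1\<close> from 1 on, where
  the outer one is evaluated at a nonpositive number.
\<close>

definition cutoff :: "real \<Rightarrow> real" where
  "cutoff s = exp 1 * flat 0 (1 - exp 2 * flat 0 (s - 1 / 2))"

lemma C_diff_cutoff: "C_diff k cutoff"
proof -
  have "C_diff k (\<lambda>s::real. s - 1 / 2)"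
    by (intro C_diff_diff C_diff_const C_diff_bounded_linear[OF bounded_linear_ident])
  note C_diff_compose[OF C_diff_flat[of k 0] this]
  then have "C_diff k (\<lambda>s. 1 - exp 2 * flat 0 (s - 1 / 2))"
    by (intro C_diff_diff C_diff_const C_diff_cmult)
  note C_diff_compose[OF C_diff_flat[of k 0] this]
  then show ?thesis
    unfolding cutoff_def[abs_def] by (rule C_diff_cmult)
qed

lemma cutoff_eq_1: "s \<le> 1 / 2 \<Longrightarrow> cutoff s = 1"
  by (simp add: cutoff_def flat_def exp_minus)

lemma cutoff_eq_0: "1 \<le> s \<Longrightarrow> cutoff s = 0"
proof -
  assume s: "1 \<le> s"
  then have "inverse (s - 1 / 2) \<le> 2"
    using le_imp_inverse_le[of "1 / 2" "s - 1 / 2"] by simp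
  then have "exp (- 2) \<le> flat 0 (s - 1 / 2)"
    using s by (simp add: flat_def)
  then have "exp 2 * exp (- 2) \<le> exp 2 * flat 0 (s - 1 / 2)"
    by (rule mult_left_mono) simp
  then have "1 - exp 2 * flat 0 (s - 1 / 2) \<le> 0"
    by (simp add: exp_minus)
  then show "cutoff s = 0"
    unfolding cutoff_def by (simp add: flat_0_eq_0_iff)
qed

definition profile :: "real \<times> real \<Rightarrow> real" where
  "profile z = 2 * snd z * cutoff (z \<bullet> z)"

lemma C_diff_profile: "C_diff k profile"
proof -
  have "C_diff k (\<lambda>z :: real \<times> real. fst z * fst z + snd z * snd z)"
    by (intro C_diff_add C_diff_mult C_diff_bounded_linear[OF bounded_linear_fst]
        C_diff_bounded_linear[OF bounded_linear_snd])
  then have "C_diff k (\<lambda>z :: real \<times> real. z \<bullet> z)"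
    by (simp add: inner_prod_def case_prod_unfold)
  then have "C_diff k (\<lambda>z :: real \<times> real. cutoff (z \<bullet> z))"
    by (rule C_diff_compose[OF C_diff_cutoff])
  then show ?thesis
    unfolding profile_def[abs_def]
    by (intro C_diff_mult C_diff_const C_diff_bounded_linear[OF bounded_linear_snd])
qed

lemma profile_outside: "z \<notin> cball 0 1 \<Longrightarrow> profile z = 0"
proof -
  assume "z \<notin> cball 0 1"
  then have "1 \<le> (norm z)\<^sup>2" by (simp add: one_le_power)
  then show ?thesis by (simp add: profile_def cutoff_eq_0 dot_square_norm)
qed

lemma pd_profile_outside:
  assumes "z \<notin> cball 0 1"
  shows "pd i profile z = 0" "pd j (pd i profile) z = 0"
proof -
  have *: "pd i profile w = 0" if "w \<notin> cball 0 1" for w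
    by (rule pd_outside_support[OF compact_cball _ that]) (rule profile_outside)
  show "pd i profile z = 0" by (rule *[OF assms])
  show "pd j (pd i profile) z = 0"
    by (rule pd_outside_support[OF compact_cball _ assms]) (rule *)
qed

text \<open>
  The profile is linear on the open set \<open>|w|\<^sup>2 < 1 / 2\<close>, which contains the closed disc of radius
  \<open>1 / 2\<close>. Having the second derivatives vanish on the closed disc makes the annuli of consecutive
  dyadic rescalings exactly disjoint.
\<close>

lemma profile_inside:
  assumes "norm z \<le> 1 / 2"
  shows "pd (0, 1) profile z = 2" "pd j (pd i profile) z = 0"
proof -
  let ?S = "{w :: real \<times> real. w \<bullet> w < 1 / 2}"
  have S: "open ?S"
    by (intro open_Collect_less continuous_intros)
  have "(norm z)\<^sup>2 \<le> (1 / 2)\<^sup>2"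
    using assms by (intro power_mono) auto
  then have z: "z \<in> ?S" by (simp add: dot_square_norm power2_eq_square)
  have lin: "bounded_linear (\<lambda>w :: real \<times> real. 2 * snd w)"
    by (rule bounded_linear_const_mult[OF bounded_linear_snd])
  have 1: "pd i profile w = 2 * snd i" if "w \<in> ?S" for w i
  proof -
    have "pd i profile w = pd i (\<lambda>w. 2 * snd w) w"
      by (rule pd_cong_open[OF S that _ C_diff_bounded_linear[OF lin]]) (simp add: profile_def cutoff_eq_1)
    then show ?thesis by (simp add: pd_linear[OF lin])
  qed
  show "pd (0, 1) profile z = 2" by (simp add: 1[OF z])
  have "pd j (pd i profile) z = pd j (\<lambda>_. 2 * snd i) z"
    by (rule pd_cong_open[OF S z 1 C_diff_const])
  then show "pd j (pd i profile) z = 0" by (simp add: pd_const)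
qed

lemma profile_derivatives_bounded:
  obtains M where "\<And>i z. i \<in> Basis \<Longrightarrow> \<bar>pd i profile z\<bar> \<le> M"
    "\<And>i j z. i \<in> Basis \<Longrightarrow> j \<in> Basis \<Longrightarrow> \<bar>pd j (pd i profile) z\<bar> \<le> M"
proof -
  have t: "profile \<in> test_functions UNIV"
    by (rule test_functionsI[where K = "cball 0 1"])
      (auto intro: C_diff_profile profile_outside simp del: mem_cball)
  have bnd: "\<exists>M. \<forall>z. \<bar>f z\<bar> \<le> M" if f: "f \<in> test_functions UNIV" for f :: "real \<times> real \<Rightarrow> real"
  proof -
    obtain K where K: "compact K" "K \<subseteq> UNIV" "\<And>z. z \<notin> K \<Longrightarrow> f z = 0"
      by (rule test_functionsE[OF f]) (rule that)
    have c: "continuous_on UNIV f"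
      by (rule C_diff_continuous[OF test_functions_C_diff[OF f, of 0]])
    obtain M where "0 \<le> M" "\<And>z. \<bar>f z\<bar> \<le> M"
      by (rule bounded_compact_support[OF c K(1)]) (erule K(3), rule that)
    then show ?thesis by blast
  qed
  have "\<forall>i\<in>Basis. \<exists>M. \<forall>z. \<bar>pd i profile z\<bar> \<le> M"
    by (intro ballI bnd test_functions_pd t)
  from bchoice[OF this] obtain M1 where M1: "\<And>i z. i \<in> Basis \<Longrightarrow> \<bar>pd i profile z\<bar> \<le> M1 i"
    by blast
  have "\<forall>p\<in>Basis \<times> Basis. \<exists>M. \<forall>z. \<bar>pd (snd p) (pd (fst p) profile) z\<bar> \<le> M"
    by (intro ballI bnd test_functions_pd t) auto
  from bchoice[OF this] obtain M2 where
    M2: "\<And>p z. p \<in> Basis \<times> Basis \<Longrightarrow> \<bar>pd (snd p) (pd (fst p) profile) z\<bar> \<le> M2 p"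
    by blast
  define S where "S = M1 ` Basis \<union> M2 ` (Basis \<times> Basis)"
  have S: "finite S" by (simp add: S_def)
  show ?thesis
  proof (rule that)
    show "\<bar>pd i profile z\<bar> \<le> Max S" if "i \<in> Basis" for i z
      by (rule order_trans[OF M1[OF that] Max_ge[OF S]]) (use that in \<open>auto simp: S_def\<close>)
    show "\<bar>pd j (pd i profile) z\<bar> \<le> Max S" if "i \<in> Basis" "j \<in> Basis" for i j z
    proof -
      have "M2 (i, j) \<in> S" using that by (simp add: S_def)
      from Max_ge[OF S this] M2[of "(i, j)" z] that show ?thesis by simp
    qed
  qed
qed

lemma square_sum_eq_sum_squares:
  fixes a :: "'b \<Rightarrow> real"
  assumes "finite J" "\<And>k l. k \<in> J \<Longrightarrow> l \<in> J \<Longrightarrow> k \<noteq> l \<Longrightarrow> a k * a l = 0"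
  shows "(\<Sum>k\<in>J. a k)\<^sup>2 = (\<Sum>k\<in>J. (a k)\<^sup>2)"
  using assms
proof (induction J rule: finite_induct)
  case (insert x F)
  have "a x * (\<Sum>k\<in>F. a k) = 0"
    unfolding sum_distrib_left by (rule sum.neutral) (use insert in auto)
  then show ?case
    using insert by (simp add: power2_sum)
qed simp

lemma measure_cball_plane:
  fixes c :: "real \<times> real"
  shows "0 \<le> r \<Longrightarrow> measure lebesgue (cball c r) = pi * r\<^sup>2"
  using content_cball[of r c] by (simp add: unit_ball_vol_2 power2_eq_square)

definition radius :: "real \<Rightarrow> nat \<Rightarrow> real" where
  "radius \<rho> k = \<rho> / 2 ^ k"

text \<open>
  An average of dyadic rescalings of the profile. The factor \<open>radius \<rho> k\<close> keeps the bound on the gradient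
  of each term independent of \<open>k\<close>. Starting at \<open>k = j\<close> makes the support shrink,
  and taking \<open>j + 1\<close> terms makes the Hessian small.
\<close>

definition spike :: "real \<Rightarrow> real \<times> real \<Rightarrow> nat \<Rightarrow> real \<times> real \<Rightarrow> real" where
  "spike \<rho> c j z = 1 / (real j + 1) *
     (\<Sum>k\<in>{j..2 * j}. radius \<rho> k * profile (inverse (radius \<rho> k) *\<^sub>R (z - c)))"

context
  fixes \<rho> :: real and c :: "real \<times> real"
  assumes \<rho>: "0 < \<rho>"
begin

lemma radius_pos: "0 < radius \<rho> k"
  using \<rho> by (simp add: radius_def)

lemma radius_antimono: "k \<le> l \<Longrightarrow> radius \<rho> l \<le> radius \<rho> k"
  using \<rho> by (simp add: radius_def divide_left_mono power_increasing)

lemma rescaled_norm_le_iff: "norm (inverse (radius \<rho> k) *\<^sub>R (z - c)) \<le> a \<longleftrightarrow> dist c z \<le> a * radius \<rho> k"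
proof -
  have "norm (inverse (radius \<rho> k) *\<^sub>R (z - c)) = dist c z / radius \<rho> k"
    using radius_pos[of k] by (simp add: dist_norm norm_minus_commute[of z c] divide_inverse mult.commute)
  then show ?thesis
    by (simp only: pos_divide_le_eq[OF radius_pos])
qed

lemma rescaled_in_cball_iff: "inverse (radius \<rho> k) *\<^sub>R (z - c) \<in> cball 0 1 \<longleftrightarrow> z \<in> cball c (radius \<rho> k)"
  using rescaled_norm_le_iff[of k z 1] by simp

lemma C_diff_spike: "C_diff m (spike \<rho> c j)"
  unfolding spike_def[abs_def]
  by (intro C_diff_cmult C_diff_sum C_diff_rescale C_diff_profile)

lemma spike_outside: "z \<notin> cball c (radius \<rho> j) \<Longrightarrow> spike \<rho> c j z = 0"
proof -
  assume z: "z \<notin> cball c (radius \<rho> j)"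
  have "profile (inverse (radius \<rho> k) *\<^sub>R (z - c)) = 0" if "j \<le> k" for k
  proof (rule profile_outside)
    show "inverse (radius \<rho> k) *\<^sub>R (z - c) \<notin> cball 0 1"
      unfolding rescaled_in_cball_iff using z radius_antimono[OF that] by simp
  qed
  then show ?thesis by (simp add: spike_def)
qed

lemma pd_spike_outside: "z \<notin> cball c (radius \<rho> j) \<Longrightarrow> pd i (spike \<rho> c j) z = 0"
  by (rule pd_outside_support[OF compact_cball]) (rule spike_outside)

lemma pd_spike:
  "pd i (spike \<rho> c j) z = 1 / (real j + 1) * (\<Sum>k\<in>{j..2 * j}. pd i profile (inverse (radius \<rho> k) *\<^sub>R (z - c)))"
proof -
  have C: "C_diff (Suc 0) (\<lambda>z. radius \<rho> k * profile (inverse (radius \<rho> k) *\<^sub>R (z - c)))" for k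
    by (intro C_diff_cmult C_diff_rescale C_diff_profile)
  have D: "C_diff (Suc 0) (\<lambda>z. profile (inverse (radius \<rho> k) *\<^sub>R (z - c)))" for k
    by (intro C_diff_rescale C_diff_profile)
  have "pd i (\<lambda>z. radius \<rho> k * profile (inverse (radius \<rho> k) *\<^sub>R (z - c))) z
      = pd i profile (inverse (radius \<rho> k) *\<^sub>R (z - c))" for k
    using radius_pos[of k]
    by (simp add: pd_cmult[OF D] pd_rescale[OF C_diff_profile[of "Suc 0"]])
  then show ?thesis
    unfolding spike_def[abs_def]
    by (subst pd_cmult[OF C_diff_sum[OF C]]) (subst pd_sum[OF C], simp)
qed

lemma pd_pd_spike:
  assumes "i \<in> Basis"
  shows "pd l (pd i (spike \<rho> c j)) z =
    1 / (real j + 1) * (\<Sum>k\<in>{j..2 * j}. inverse (radius \<rho> k) * pd l (pd i profile) (inverse (radius \<rho> k) *\<^sub>R (z - c)))"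
proof -
  have E: "C_diff (Suc 0) (pd i profile)"
    by (rule C_diff_pd[OF C_diff_profile assms])
  have C: "C_diff (Suc 0) (\<lambda>z. pd i profile (inverse (radius \<rho> k) *\<^sub>R (z - c)))" for k
    by (rule C_diff_rescale[OF E])
  show ?thesis
    unfolding pd_spike[abs_def]
    by (subst pd_cmult[OF C_diff_sum[OF C]]) (subst pd_sum[OF C], simp add: pd_rescale[OF E])
qed

text \<open>
  The inner discs of all terms contain the smallest one, of index \<open>2 * j\<close>, so there every term has slope 2.
\<close>

lemma pd_spike_center:
  assumes "dist c z \<le> radius \<rho> (2 * j) / 2"
  shows "pd (0, 1) (spike \<rho> c j) z = 2"
proof -
  have "pd (0, 1) profile (inverse (radius \<rho> k) *\<^sub>R (z - c)) = 2" if "k \<in> {j..2 * j}" for k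
  proof (rule profile_inside(1))
    show "norm (inverse (radius \<rho> k) *\<^sub>R (z - c)) \<le> 1 / 2"
      using assms radius_antimono[of k "2 * j"] that by (subst rescaled_norm_le_iff) auto
  qed
  then show ?thesis
    by (simp add: pd_spike field_simps)
qed

lemma abs_pd_spike_le:
  assumes M: "\<And>w. \<bar>pd i profile w\<bar> \<le> M"
  shows "\<bar>pd i (spike \<rho> c j) z\<bar> \<le> M"
proof -
  have "\<bar>\<Sum>k\<in>{j..2 * j}. pd i profile (inverse (radius \<rho> k) *\<^sub>R (z - c))\<bar> \<le> (\<Sum>k\<in>{j..2 * j}. M)"
    by (rule order_trans[OF sum_abs sum_mono]) (rule M)
  then show ?thesis
    by (simp add: pd_spike abs_mult field_simps)
qed

text \<open>
  At each point at most one term of the sum has a nonzero second derivative, because these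
  derivatives live in the annuli \<open>radius \<rho> k / 2 < dist c z \<le> radius \<rho> k\<close>. So the
  square of the sum is the sum of the squares, without mixed terms.
\<close>

lemma square_pd_pd_spike_le:
  assumes i: "i \<in> Basis" and M: "\<And>w. \<bar>pd l (pd i profile) w\<bar> \<le> M"
  shows "(pd l (pd i (spike \<rho> c j)) z)\<^sup>2 \<le>
    (1 / (real j + 1))\<^sup>2 * (\<Sum>k\<in>{j..2 * j}. (M / radius \<rho> k)\<^sup>2 * indicator (cball c (radius \<rho> k)) z)"
proof -
  define a where "a k = inverse (radius \<rho> k) * pd l (pd i profile) (inverse (radius \<rho> k) *\<^sub>R (z - c))" for k
  have out: "a k = 0" if "radius \<rho> k < dist c z" for k
  proof -
    have "pd l (pd i profile) (inverse (radius \<rho> k) *\<^sub>R (z - c)) = 0"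
      by (rule pd_profile_outside(2), unfold rescaled_in_cball_iff) (use that in simp)
    then show ?thesis by (simp add: a_def)
  qed
  have ins: "a k = 0" if "dist c z \<le> radius \<rho> k / 2" for k
  proof -
    have "norm (inverse (radius \<rho> k) *\<^sub>R (z - c)) \<le> 1 / 2"
      unfolding rescaled_norm_le_iff using that by simp
    from profile_inside(2)[OF this] show ?thesis by (simp add: a_def)
  qed
  have disj: "a k * a m = 0" if "k < m" for k m
  proof (cases "radius \<rho> m < dist c z")
    case False
    \<comment> \<open>The support of the smaller term \<open>m\<close> lies in the disc where the term \<open>k\<close> is linear.\<close>
    have "radius \<rho> m \<le> radius \<rho> (Suc k)"
      using that by (intro radius_antimono) simp
    also have "\<dots> = radius \<rho> k / 2" by (simp add: radius_def)
    finally have "a k = 0" using False by (intro ins) simp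
    then show ?thesis by simp
  qed (simp add: out)
  have "(\<Sum>k\<in>{j..2 * j}. a k)\<^sup>2 = (\<Sum>k\<in>{j..2 * j}. (a k)\<^sup>2)"
    by (rule square_sum_eq_sum_squares) (use disj in \<open>auto simp: neq_iff mult.commute\<close>)
  also have "\<dots> \<le> (\<Sum>k\<in>{j..2 * j}. (M / radius \<rho> k)\<^sup>2 * indicator (cball c (radius \<rho> k)) z)"
  proof (rule sum_mono)
    fix k
    show "(a k)\<^sup>2 \<le> (M / radius \<rho> k)\<^sup>2 * indicator (cball c (radius \<rho> k)) z"
    proof (cases "z \<in> cball c (radius \<rho> k)")
      case True
      have "\<bar>a k\<bar> \<le> M / radius \<rho> k"
        using M[of "inverse (radius \<rho> k) *\<^sub>R (z - c)"] radius_pos[of k]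
        by (simp add: a_def abs_mult field_simps)
      then have "\<bar>a k\<bar>\<^sup>2 \<le> (M / radius \<rho> k)\<^sup>2" by (rule power_mono) simp
      then show ?thesis using True by simp
    next
      case False
      then show ?thesis by (simp add: out)
    qed
  qed
  finally have "(1 / (real j + 1))\<^sup>2 * (\<Sum>k\<in>{j..2 * j}. a k)\<^sup>2 \<le>
      (1 / (real j + 1))\<^sup>2 * (\<Sum>k\<in>{j..2 * j}. (M / radius \<rho> k)\<^sup>2 * indicator (cball c (radius \<rho> k)) z)"
    by (rule mult_left_mono) simp
  then show ?thesis
    unfolding pd_pd_spike[OF i] power_mult_distrib a_def .
qed

text \<open>
  The area of a disc of radius \<open>r\<close> cancels the factor \<open>1 / r\<^sup>2\<close> in the bound on the
  squared second derivatives of a rescaled profile. This is the scale invariance of the critical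
  dimension: each of the \<open>j + 1\<close> terms contributes the same amount, and the weight
  \<open>1 / (j + 1)\<^sup>2\<close> leaves \<open>1 / (j + 1)\<close>.
\<close>

lemma integral_classical_density_spike_le:
  assumes M: "\<And>i w. i \<in> Basis \<Longrightarrow> \<bar>pd i profile w\<bar> \<le> M"
    "\<And>i l w. i \<in> Basis \<Longrightarrow> l \<in> Basis \<Longrightarrow> \<bar>pd l (pd i profile) w\<bar> \<le> M"
    and int: "integrable lebesgue (classical_density (spike \<rho> c j) \<epsilon>)"
  shows "integral\<^sup>L lebesgue (classical_density (spike \<rho> c j) \<epsilon>)
    \<le> 4 * pi * \<epsilon>\<^sup>2 * M\<^sup>2 / (real j + 1) + pi * M\<^sup>2 * (radius \<rho> j)\<^sup>2"
proof -
  define G where "G z = (1 / (real j + 1))\<^sup>2 *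
      (\<Sum>k\<in>{j..2 * j}. (M / radius \<rho> k)\<^sup>2 * indicator (cball c (radius \<rho> k)) z)" for z
  have ind: "integrable lebesgue (\<lambda>z. indicator (cball c (radius \<rho> k)) z :: real)" for k
    by (rule integrable_real_indicator) (use emeasure_lborel_cball_finite in auto)
  have G: "integrable lebesgue G"
    unfolding G_def[abs_def] by (intro integrable_mult_right Bochner_Integration.integrable_sum ind)
  have "integral\<^sup>L lebesgue G = (1 / (real j + 1))\<^sup>2 * (\<Sum>k\<in>{j..2 * j}. (M / radius \<rho> k)\<^sup>2 * (pi * (radius \<rho> k)\<^sup>2))"
  proof -
    have "integral\<^sup>L lebesgue (indicator (cball c (radius \<rho> k))) = pi * (radius \<rho> k)\<^sup>2" for k
      using measure_cball_plane[OF less_imp_le[OF radius_pos], of c k] by simp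
    then have "integral\<^sup>L lebesgue (\<lambda>z. (M / radius \<rho> k)\<^sup>2 * indicator (cball c (radius \<rho> k)) z)
        = (M / radius \<rho> k)\<^sup>2 * (pi * (radius \<rho> k)\<^sup>2)" for k
      by (simp only: integral_mult_right_zero)
    then show ?thesis
      unfolding G_def[abs_def]
      by (simp only: integral_mult_right_zero Bochner_Integration.integral_sum[OF integrable_mult_right[OF ind]])
  qed
  also have "\<dots> = (1 / (real j + 1))\<^sup>2 * (\<Sum>k\<in>{j..2 * j}. pi * M\<^sup>2)"
    using radius_pos by (simp add: power_divide less_imp_neq[symmetric])
  also have "\<dots> = pi * M\<^sup>2 / (real j + 1)"
    by (simp add: power2_eq_square divide_simps)
  finally have intG: "integral\<^sup>L lebesgue G = pi * M\<^sup>2 / (real j + 1)" .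
  have "integral\<^sup>L lebesgue (classical_density (spike \<rho> c j) \<epsilon>)
      \<le> integral\<^sup>L lebesgue (\<lambda>z. \<epsilon>\<^sup>2 * (4 * G z) + M\<^sup>2 * indicator (cball c (radius \<rho> j)) z)"
  proof (rule integral_mono[OF int])
    show "integrable lebesgue (\<lambda>z. \<epsilon>\<^sup>2 * (4 * G z) + M\<^sup>2 * indicator (cball c (radius \<rho> j)) z)"
      by (intro Bochner_Integration.integrable_add integrable_mult_right G ind)
    fix z
    have 2: "(pd l (pd i (spike \<rho> c j)) z)\<^sup>2 \<le> G z" if "i \<in> Basis" "l \<in> Basis" for i l
      unfolding G_def by (rule square_pd_pd_spike_le[OF that(1) M(2)[OF that]])
    have "(pd (1, 0) (spike \<rho> c j) z)\<^sup>2 \<le> M\<^sup>2 * indicator (cball c (radius \<rho> j)) z"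
    proof (cases "z \<in> cball c (radius \<rho> j)")
      case True
      have "\<bar>pd (1, 0) (spike \<rho> c j) z\<bar>\<^sup>2 \<le> M\<^sup>2"
        by (intro power_mono abs_pd_spike_le M(1)) (auto simp: Basis_real_prod)
      then show ?thesis using True by simp
    next
      case False
      then show ?thesis
        using pd_spike_outside[OF False] by simp
    qed
    moreover have "\<epsilon>\<^sup>2 * ((pd (1, 0) (pd (1, 0) (spike \<rho> c j)) z)\<^sup>2 + (pd (0, 1) (pd (1, 0) (spike \<rho> c j)) z)\<^sup>2
          + (pd (1, 0) (pd (0, 1) (spike \<rho> c j)) z)\<^sup>2 + (pd (0, 1) (pd (0, 1) (spike \<rho> c j)) z)\<^sup>2) \<le> \<epsilon>\<^sup>2 * (4 * G z)"
      using 2[of "(1, 0)" "(1, 0)"] 2[of "(1, 0)" "(0, 1)"] 2[of "(0, 1)" "(1, 0)"] 2[of "(0, 1)" "(0, 1)"]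
      by (intro mult_left_mono) (auto simp: Basis_real_prod)
    ultimately show "classical_density (spike \<rho> c j) \<epsilon> z \<le> \<epsilon>\<^sup>2 * (4 * G z) + M\<^sup>2 * indicator (cball c (radius \<rho> j)) z"
      unfolding classical_density_def by linarith
  qed
  also have "\<dots> = \<epsilon>\<^sup>2 * (4 * integral\<^sup>L lebesgue G) + M\<^sup>2 * measure lebesgue (cball c (radius \<rho> j))"
    using G ind by simp
  also have "\<dots> = 4 * pi * \<epsilon>\<^sup>2 * M\<^sup>2 / (real j + 1) + pi * M\<^sup>2 * (radius \<rho> j)\<^sup>2"
    unfolding measure_cball_plane[OF less_imp_le[OF radius_pos]] intG by (simp add: algebra_simps)
  finally show ?thesis .
qed

end

theorem theorem4p1:
  fixes L \<epsilon> \<Delta> :: real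
  assumes "L > 0" and "\<epsilon> > 0" and "\<Delta> > 0"
  shows "\<exists>v :: nat \<Rightarrow> real \<times> real \<Rightarrow> real.
           (\<forall>j. v j \<in> A3 L) \<and>
           (\<forall>\<^sub>F j in sequentially. measure lebesgue (Bset L (v j)) > 0) \<and>
           (\<lambda>j. measure lebesgue (Bset L (v j))) \<longlonglongrightarrow> 0 \<and>
           (\<lambda>j. E3 L \<epsilon> \<Delta> (v j) - E3 L \<epsilon> \<Delta> (\<lambda>z. 0)) \<longlonglongrightarrow> 0"
proof -
  define c where "c = (L / 2, 1 / 2 :: real)"
  have "c \<in> interior (Om L)"
    using \<open>L > 0\<close> by (auto simp: c_def interior_Om mem_box Basis_real_prod)
  then obtain \<rho> where \<rho>: "0 < \<rho>" "cball c \<rho> \<subseteq> interior (Om L)"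
    using open_contains_cball[of "interior (Om L)"] by auto
  obtain M where M: "\<And>i w. i \<in> Basis \<Longrightarrow> \<bar>pd i profile w\<bar> \<le> M"
    "\<And>i l w. i \<in> Basis \<Longrightarrow> l \<in> Basis \<Longrightarrow> \<bar>pd l (pd i profile) w\<bar> \<le> M"
    using profile_derivatives_bounded by metis
  define v where "v = spike \<rho> c"
  have ball: "cball c (radius \<rho> j) \<subseteq> interior (Om L)" for j
    using \<rho>(2) radius_antimono[OF \<rho>(1), of 0 j] by (auto simp: radius_def)
  have test: "v j \<in> test_functions (interior (Om L))" for j
    unfolding v_def
    by (rule test_functionsI[OF C_diff_spike[OF \<rho>(1)] compact_cball ball spike_outside[OF \<rho>(1)]])
  have rad0: "(\<lambda>j. radius \<rho> j) \<longlonglongrightarrow> 0"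
    unfolding radius_def by (rule LIMSEQ_divide_realpow_zero) simp
  define B where "B j = {z \<in> Om L. 1 \<le> \<bar>pd (0, 1) (v j) z\<bar>}" for j
  have Bset_B: "measure lebesgue (Bset L (v j)) = measure lebesgue (B j)"
    and B_meas: "B j \<in> lmeasurable" for j
    using Bset_test_function(1,3)[OF test] by (simp_all add: B_def)
  have pos: "measure lebesgue (Bset L (v j)) > 0" for j
  proof -
    let ?r = "radius \<rho> (2 * j) / 2"
    have r: "0 < ?r" using radius_pos[OF \<rho>(1)] by simp
    have "cball c ?r \<subseteq> B j"
    proof
      fix z assume z: "z \<in> cball c ?r"
      then have "z \<in> cball c (radius \<rho> (2 * j))" using r by simp
      then have "z \<in> Om L" using ball[of "2 * j"] interior_subset by blast
      then show "z \<in> B j"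
        using z by (simp add: B_def v_def pd_spike_center[OF \<rho>(1)])
    qed
    then have "measure lebesgue (cball c ?r) \<le> measure lebesgue (B j)"
      using B_meas by (intro measure_mono_fmeasurable) auto
    moreover have "0 < measure lebesgue (cball c ?r)"
      unfolding measure_cball_plane[OF less_imp_le[OF r]]
      by (intro mult_pos_pos zero_less_power pi_gt_zero r)
    ultimately show ?thesis
      unfolding Bset_B by (rule less_le_trans[rotated])
  qed
  have upper: "measure lebesgue (Bset L (v j)) \<le> pi * (radius \<rho> j)\<^sup>2" for j
  proof -
    have "B j \<subseteq> cball c (radius \<rho> j)"
    proof
      fix z assume "z \<in> B j"
      then have nz: "pd (0, 1) (v j) z \<noteq> 0" by (auto simp: B_def)
      show "z \<in> cball c (radius \<rho> j)"
      proof (rule ccontr)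
        assume "z \<notin> cball c (radius \<rho> j)"
        from pd_spike_outside[OF \<rho>(1) this] nz show False by (simp add: v_def)
      qed
    qed
    then have "measure lebesgue (B j) \<le> measure lebesgue (cball c (radius \<rho> j))"
      using B_meas by (intro measure_mono_fmeasurable) auto
    then show ?thesis
      by (simp only: Bset_B measure_cball_plane[OF less_imp_le[OF radius_pos[OF \<rho>(1)]]])
  qed
  have squeeze: "f \<longlonglongrightarrow> 0" if "\<And>j. 0 \<le> f j" "\<And>j. f j \<le> g j" "g \<longlonglongrightarrow> 0" for f g :: "nat \<Rightarrow> real"
    by (rule tendsto_sandwich[OF _ _ tendsto_const that(3)]) (use that in auto)
  have "(\<lambda>j. pi * (radius \<rho> j)\<^sup>2) \<longlonglongrightarrow> pi * 0\<^sup>2"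
    by (intro tendsto_intros rad0)
  then have "(\<lambda>j. pi * (radius \<rho> j)\<^sup>2) \<longlonglongrightarrow> 0" by simp
  from squeeze[OF measure_nonneg upper this]
  have B0: "(\<lambda>j. measure lebesgue (Bset L (v j))) \<longlonglongrightarrow> 0" .
  have "(\<lambda>j. 4 * pi * \<epsilon>\<^sup>2 * M\<^sup>2 / (real j + 1) + pi * M\<^sup>2 * (radius \<rho> j)\<^sup>2) \<longlonglongrightarrow> 0 + pi * M\<^sup>2 * 0\<^sup>2"
  proof (intro tendsto_intros rad0)
    show "(\<lambda>j. 4 * pi * \<epsilon>\<^sup>2 * M\<^sup>2 / (real j + 1)) \<longlonglongrightarrow> 0"
      using LIMSEQ_Suc[OF lim_const_over_n[of "4 * pi * \<epsilon>\<^sup>2 * M\<^sup>2"]] by (simp add: add.commute)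
  qed
  then have bound0: "(\<lambda>j. 4 * pi * \<epsilon>\<^sup>2 * M\<^sup>2 / (real j + 1) + pi * M\<^sup>2 * (radius \<rho> j)\<^sup>2) \<longlonglongrightarrow> 0"
    by simp
  have le: "integral\<^sup>L lebesgue (classical_density (v j) \<epsilon>)
      \<le> 4 * pi * \<epsilon>\<^sup>2 * M\<^sup>2 / (real j + 1) + pi * M\<^sup>2 * (radius \<rho> j)\<^sup>2" for j
    unfolding v_def
    by (rule integral_classical_density_spike_le[OF \<rho>(1) M E3_test_function(1)[OF test[unfolded v_def]]])
  have "0 \<le> integral\<^sup>L lebesgue (classical_density (v j) \<epsilon>)" for j
    by (rule integral_nonneg_AE) (simp add: classical_density_def)
  from squeeze[OF this le bound0]
  have "(\<lambda>j. integral\<^sup>L lebesgue (classical_density (v j) \<epsilon>)) \<longlonglongrightarrow> 0" .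
  then have "(\<lambda>j. integral\<^sup>L lebesgue (classical_density (v j) \<epsilon>) - \<Delta> * measure lebesgue (Bset L (v j))) \<longlonglongrightarrow> 0 - \<Delta> * 0"
    by (intro tendsto_intros B0)
  then have "(\<lambda>j. E3 L \<epsilon> \<Delta> (v j) - E3 L \<epsilon> \<Delta> (\<lambda>z. 0)) \<longlonglongrightarrow> 0"
    by (simp add: E3_diff_test_function[OF test])
  then show ?thesis
    using test_function_in_A3[OF test] pos B0 by (intro exI[of _ v]) auto
qed

end
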